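(* In the Sinkhorn setting described in the context, assume $$C_1:=\sup_{t\ge0}\inf_{\alpha>0}\frac{2}{\alpha}\Big(\frac32+\log\int e^{\alpha|\varphi_t-\varphi_*|}d\mu\Big)<\infty.$$ Let $t_0=\inf\{t\ge0:H(\mu_{2t}|\mu)\le1\}$, $t_1=(t_0-1)\vee0$, and $\kappa=(\tfrac32C_1)^{-1}\wedge(2H(\pi_*|R))^{-1/2}$ (with $0^{-1/2}:=\infty$). Then $t_1\le((t_2\wedge t_3)-1)^+$, where $$t_2:=\lceil H(\pi_*|R)-H(\pi_0|R)\rceil,\qquad t_3:=\inf\{t\in\mathbb{N}:\lfloor t/2\rfloor\log(1+\kappa)+\log t\ge\log(2H(\pi_*|\pi_0))\}.$$ (a) For integers $0\le t<t_1$: $H(\pi_*|\pi_{2t})\le H(\pi_*|\pi_0)(1+\kappa)^{-t}\le H(\pi_*|R)(1+\kappa)^{-t}$. (b) For integers $t\ge t_1$: $$H(\pi_*|\pi_{2t})\le\frac{1}{H(\pi_*|\pi_{2t_1})^{-1}+\frac12\kappa^2(t-t_1)}\le\frac{1}{H(\pi_*|R)^{-1}+\frac12\kappa^2(t-t_1)}\le5\,\frac{C_1^2\vee H(\pi_*|R)}{t-t_1}.$$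
   Context: Sinkhorn setting: $(\mathsf{X},\mu)$, $(\mathsf{Y},\nu)$ are Polish probability spaces, $c:\mathsf{X}\times\mathsf{Y}\to\mathbb{R}$ is measurable, $e^{-c}\in L^1(\mu\otimes\nu)$, and $\mathcal{C}_1(\mu,\nu):=\inf_{\pi\in\Pi(\mu,\nu)}\int c\,d\pi+H(\pi|\mu\otimes\nu)$ is finite, where $\Pi(\mu,\nu)$ is the set of couplings and $H(\rho|\sigma)=\int\log\frac{d\rho}{d\sigma}d\rho$ if $\rho\ll\sigma$, $+\infty$ otherwise. $\pi_*$ is the unique minimizer; $d\pi_*=e^{\varphi_*\oplus\psi_*-c}d(\mu\otimes\nu)$ with potentials $\varphi_*,\psi_*$ (unique up to $(\varphi_*-a,\psi_*+a)$), $(\varphi\oplus\psi)(x,y)=\varphi(x)+\psi(y)$. Let $\xi=\int e^{-c}d(\mu\otimes\nu)$ and $dR=\xi^{-1}e^{-c}d(\mu\otimes\nu)$. Sinkhorn iterates: $\varphi_0:=0$, and for $t\ge0$, $\psi_t(y):=-\log\int e^{\varphi_t(x)-c(x,y)}\mu(dx)$, $\varphi_{t+1}(x):=-\log\int e^{\psi_t(y)-c(x,y)}\nu(dy)$; set $\psi_{-1}:=-\log\xi$. Define probability measures $d\pi_{2t}=e^{\varphi_t\oplus\psi_t-c}d(\mu\otimes\nu)$ and $d\pi_{2t-1}=e^{\varphi_t\oplus\psi_{t-1}-c}d(\mu\otimes\nu)$ for $t\ge0$ (so $\pi_{-1}=R$). Then $\pi_{2t}$ has marginals $(\mu_{2t},\nu)$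 and $\pi_{2t-1}$ has marginals $(\mu,\nu_{2t-1})$, with $d\mu_{2t}/d\mu=e^{\varphi_t-\varphi_{t+1}}$ and $d\nu_{2t-1}/d\nu=e^{\psi_{t-1}-\psi_t}$. Convention: a bound with zero denominator is $+\infty$. *)

theory Defs
  imports "HOL-Probability.Probability"
begin

text \<open>Relative entropy H(rho|sigma) = integral of log(d rho / d sigma) d rho if rho << sigma,
  and +infinity otherwise.  For probability measures the negative part of the integrand is
  always rho-integrable, so a non-integrable log-density means the integral is +infinity.\<close>
definition rel_ent :: "'a measure \<Rightarrow> 'a measure \<Rightarrow> ereal" where
  "rel_ent \<rho> \<sigma> =
     (if sets \<rho> = sets \<sigma> \<and> absolutely_continuous \<sigma> \<rho> then
        (if integrable \<rho> (\<lambda>z. ln (enn2real (RN_deriv \<sigma> \<rho> z)))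
         then ereal (\<integral>z. ln (enn2real (RN_deriv \<sigma> \<rho> z)) \<partial>\<rho>)
         else \<infinity>)
      else \<infinity>)"

definition eln :: "ereal \<Rightarrow> ereal" where
  "eln x = (if x \<le> 0 then -\<infinity> else if x = \<infinity> then \<infinity> else ereal (ln (real_of_ereal x)))"

definition couplings :: "'a measure \<Rightarrow> 'b measure \<Rightarrow> ('a \<times> 'b) measure set" where
  "couplings \<mu> \<nu> = {\<pi>. sets \<pi> = sets (\<mu> \<Otimes>\<^sub>M \<nu>) \<and> prob_space \<pi> \<and>
                        distr \<pi> \<mu> fst = \<mu> \<and> distr \<pi> \<nu> snd = \<nu>}"

text \<open>Entropic transport cost  int c d pi + H(pi | mu x nu)  (+infinity if c is not
  pi-integrable; under the standing assumptions the negative part of c is always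
  integrable when H is finite, so this is the usual value).\<close>
definition eot_cost :: "'a measure \<Rightarrow> 'b measure \<Rightarrow> ('a \<Rightarrow> 'b \<Rightarrow> real) \<Rightarrow> ('a \<times> 'b) measure \<Rightarrow> ereal" where
  "eot_cost \<mu> \<nu> c \<pi> =
     (if integrable \<pi> (case_prod c)
      then ereal (\<integral>z. case_prod c z \<partial>\<pi>) + rel_ent \<pi> (\<mu> \<Otimes>\<^sub>M \<nu>)
      else \<infinity>)"

fun sinkhorn :: "'a measure \<Rightarrow> 'b measure \<Rightarrow> ('a \<Rightarrow> 'b \<Rightarrow> real) \<Rightarrow> nat \<Rightarrow> ('a \<Rightarrow> real) \<times> ('b \<Rightarrow> real)" where
  "sinkhorn \<mu> \<nu> c 0 =
     ((\<lambda>_. 0), (\<lambda>y. - ln (\<integral>x. exp (0 - c x y) \<partial>\<mu>)))"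
| "sinkhorn \<mu> \<nu> c (Suc t) =
     (let \<psi> = snd (sinkhorn \<mu> \<nu> c t);
          \<phi>' = (\<lambda>x. - ln (\<integral>y. exp (\<psi> y - c x y) \<partial>\<nu>))
      in (\<phi>', (\<lambda>y. - ln (\<integral>x. exp (\<phi>' x - c x y) \<partial>\<mu>))))"

definition sk_phi :: "'a measure \<Rightarrow> 'b measure \<Rightarrow> ('a \<Rightarrow> 'b \<Rightarrow> real) \<Rightarrow> nat \<Rightarrow> 'a \<Rightarrow> real" where
  "sk_phi \<mu> \<nu> c t = fst (sinkhorn \<mu> \<nu> c t)"

definition sk_psi :: "'a measure \<Rightarrow> 'b measure \<Rightarrow> ('a \<Rightarrow> 'b \<Rightarrow> real) \<Rightarrow> nat \<Rightarrow> 'b \<Rightarrow> real" where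
  "sk_psi \<mu> \<nu> c t = snd (sinkhorn \<mu> \<nu> c t)"

definition pi_even :: "'a measure \<Rightarrow> 'b measure \<Rightarrow> ('a \<Rightarrow> 'b \<Rightarrow> real) \<Rightarrow> nat \<Rightarrow> ('a \<times> 'b) measure" where
  "pi_even \<mu> \<nu> c t = density (\<mu> \<Otimes>\<^sub>M \<nu>)
     (\<lambda>(x, y). ennreal (exp (sk_phi \<mu> \<nu> c t x + sk_psi \<mu> \<nu> c t y - c x y)))"

definition mu_even :: "'a measure \<Rightarrow> 'b measure \<Rightarrow> ('a \<Rightarrow> 'b \<Rightarrow> real) \<Rightarrow> nat \<Rightarrow> 'a measure" where
  "mu_even \<mu> \<nu> c t = distr (pi_even \<mu> \<nu> c t) \<mu> fst"

definition sk_xi :: "'a measure \<Rightarrow> 'b measure \<Rightarrow> ('a \<Rightarrow> 'b \<Rightarrow> real) \<Rightarrow> real" where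
  "sk_xi \<mu> \<nu> c = (\<integral>(x, y). exp (- c x y) \<partial>(\<mu> \<Otimes>\<^sub>M \<nu>))"

definition ref_R :: "'a measure \<Rightarrow> 'b measure \<Rightarrow> ('a \<Rightarrow> 'b \<Rightarrow> real) \<Rightarrow> ('a \<times> 'b) measure" where
  "ref_R \<mu> \<nu> c = density (\<mu> \<Otimes>\<^sub>M \<nu>) (\<lambda>(x, y). ennreal (exp (- c x y) / sk_xi \<mu> \<nu> c))"

definition sk_C1 :: "'a measure \<Rightarrow> 'b measure \<Rightarrow> ('a \<Rightarrow> 'b \<Rightarrow> real) \<Rightarrow> ('a \<Rightarrow> real) \<Rightarrow> ereal" where
  "sk_C1 \<mu> \<nu> c \<phi>s =
     (SUP t. INF \<alpha>\<in>{0<..}. ereal (2 / \<alpha>) *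
        (ereal (3/2) + eln (enn2ereal (\<integral>\<^sup>+ x. ennreal (exp (\<alpha> * \<bar>sk_phi \<mu> \<nu> c t x - \<phi>s x\<bar>)) \<partial>\<mu>))))"

end

theory Submission
  imports Defs
begin

text \<open>
  If \<open>\<integral> exp (- f) dP \<le> 1\<close> for a probability \<open>P\<close>, then \<open>f\<close> has integrable negative part and, when
  integrable, nonnegative mean. Applied to ratios of Gibbs measures, this one fact yields both the
  integrability of all potentials and every entropy inequality needed. Write \<open>h t = H(\<pi>*|\<pi>\<^sub>2\<^sub>t)\<close> and
  \<open>d t = H(\<mu>\<^sub>2\<^sub>t|\<mu>)\<close>. Then \<open>d\<close> is decreasing and \<open>d (t + 1) \<le> h t - h (t + 1)\<close>, while symmetrising,
  \<open>h t \<le> H(\<pi>*|\<pi>\<^sub>2\<^sub>t) + H(\<pi>\<^sub>2\<^sub>t|\<pi>*) = \<integral> (\<phi>\<^sub>t - \<phi>*) d(\<mu>\<^sub>2\<^sub>t - \<mu>)\<close>, and a weighted Pinsker inequality give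
  \<open>h t \<le> 3/2 C\<^sub>1 max (d t) (sqrt (d t))\<close>. While \<open>d > 1\<close> the resulting recursion is linear and \<open>h\<close> drops
  by more than 1 per step; afterwards \<open>h t - h (t + 1) \<ge> \<kappa>\<^sup>2 (h (t + 1))\<^sup>2\<close>, whence the rate \<open>1/t\<close>.
\<close>

subsection \<open>Entropy, exponential moments and densities\<close>

lemma integrable_sandwich:
  fixes f l u :: "'a \<Rightarrow> real"
  assumes "integrable M l" "integrable M u" "f \<in> borel_measurable M"
    and "\<And>x. x \<in> space M \<Longrightarrow> l x \<le> f x" "\<And>x. x \<in> space M \<Longrightarrow> f x \<le> u x"
  shows "integrable M f"
proof (rule Bochner_Integration.integrable_bound)
  show "integrable M (\<lambda>x. \<bar>l x\<bar> + \<bar>u x\<bar>)"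
    using assms by auto
  show "AE x in M. norm (f x) \<le> norm (\<bar>l x\<bar> + \<bar>u x\<bar>)"
    using assms(4,5) by (intro AE_I2) fastforce
qed (use assms in auto)

text \<open>Both parts rest on \<open>1 - f \<le> exp (- f)\<close>: the exponential dominates the
  negative part of \<open>f\<close>, and integrating the inequality gives the sign of the
  mean.\<close>

lemma (in prob_space) exp_neg_mean_le_1:
  fixes f :: "'a \<Rightarrow> real"
  assumes [measurable]: "f \<in> borel_measurable M"
    and exp: "(\<integral>\<^sup>+x. ennreal (exp (- f x)) \<partial>M) \<le> 1"
  shows "integrable M (\<lambda>x. max 0 (- f x))"
    and "integrable M f \<Longrightarrow> 0 \<le> (\<integral>x. f x \<partial>M)"
proof -
  have int: "integrable M (\<lambda>x. exp (- f x))"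
    using exp by (intro integrableI_nonneg) (auto intro: le_less_trans)
  have 1: "(\<integral>x. exp (- f x) \<partial>M) \<le> 1"
    using exp by (subst integral_eq_nn_integral) (auto intro: enn2real_leI)
  show "integrable M (\<lambda>x. max 0 (- f x))"
  proof (rule integrable_sandwich[OF _ int])
    show "integrable M (\<lambda>x. 0 :: real)" by simp
    fix x
    show "max 0 (- f x) \<le> exp (- f x)"
      using exp_ge_add_one_self[of "- f x"] exp_ge_zero[of "- f x"] by linarith
  qed auto
  assume f: "integrable M f"
  have "(\<integral>x. 1 - exp (- f x) \<partial>M) \<le> (\<integral>x. f x \<partial>M)"
  proof (rule integral_mono)
    fix x
    show "1 - exp (- f x) \<le> f x"
      using exp_ge_add_one_self[of "- f x"] by linarith
  qed (use f int in auto)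
  moreover have "(\<integral>x. 1 - exp (- f x) \<partial>M) = 1 - (\<integral>x. exp (- f x) \<partial>M)"
    using int by (simp add: prob_space)
  ultimately show "0 \<le> (\<integral>x. f x \<partial>M)"
    using 1 by linarith
qed

text \<open>Radon-Nikodym derivatives are unique almost everywhere, so the logarithm of the
  derivative is \<open>k\<close>. The infinite branch is kept because the entropy of
  \<open>\<mu>\<^sub>0\<close> may be infinite.\<close>

lemma rel_ent_density_exp:
  fixes k :: "'a \<Rightarrow> real"
  assumes "sigma_finite_measure \<sigma>" and k[measurable]: "k \<in> borel_measurable \<sigma>"
  defines "\<rho> \<equiv> density \<sigma> (\<lambda>z. ennreal (exp (k z)))"
  shows "rel_ent \<rho> \<sigma> = (if integrable \<rho> k then ereal (\<integral>z. k z \<partial>\<rho>) else \<infinity>)"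
proof -
  interpret sigma_finite_measure \<sigma> by fact
  have ac: "absolutely_continuous \<sigma> \<rho>"
    unfolding \<rho>_def by (rule absolutely_continuousI_density) measurable
  have "AE z in \<sigma>. ennreal (exp (k z)) = RN_deriv \<sigma> \<rho> z"
    by (rule RN_deriv_unique) (auto simp: \<rho>_def)
  then have "AE z in \<rho>. ln (enn2real (RN_deriv \<sigma> \<rho> z)) = k z"
    unfolding \<rho>_def[symmetric]
    by (subst \<rho>_def, subst AE_density)
      (auto elim!: eventually_mono, metis enn2real_ennreal exp_ge_zero ln_exp)
  moreover have [measurable]: "k \<in> borel_measurable \<rho>"
    by (simp add: \<rho>_def)
  moreover have [measurable]: "(\<lambda>z. ln (enn2real (RN_deriv \<sigma> \<rho> z))) \<in> borel_measurable \<rho>"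
    by (simp add: \<rho>_def)
  ultimately have "integrable \<rho> (\<lambda>z. ln (enn2real (RN_deriv \<sigma> \<rho> z))) \<longleftrightarrow> integrable \<rho> k"
    and "(\<integral>z. ln (enn2real (RN_deriv \<sigma> \<rho> z)) \<partial>\<rho>) = (\<integral>z. k z \<partial>\<rho>)"
    using integrable_cong_AE[of "\<lambda>z. ln (enn2real (RN_deriv \<sigma> \<rho> z))" \<rho> k]
      integral_cong_AE[of "\<lambda>z. ln (enn2real (RN_deriv \<sigma> \<rho> z))" \<rho> k]
    by auto
  with ac show ?thesis
    by (simp add: rel_ent_def \<rho>_def)
qed

section \<open>Marginals of densities and one half step of the iteration\<close>

lemma (in pair_prob_space) distr_fst_density:
  assumes [measurable]: "k \<in> borel_measurable (M1 \<Otimes>\<^sub>M M2)"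
  shows "distr (density (M1 \<Otimes>\<^sub>M M2) k) M1 fst = density M1 (\<lambda>x. \<integral>\<^sup>+y. k (x, y) \<partial>M2)"
proof (rule measure_eqI)
  fix A assume "A \<in> sets (distr (density (M1 \<Otimes>\<^sub>M M2) k) M1 fst)"
  then have [measurable]: "A \<in> sets M1" by simp
  have "emeasure (distr (density (M1 \<Otimes>\<^sub>M M2) k) M1 fst) A =
      (\<integral>\<^sup>+z. k z * indicator A (fst z) \<partial>(M1 \<Otimes>\<^sub>M M2))"
    by (subst emeasure_distr)
      (auto simp: emeasure_density indicator_def intro!: nn_integral_cong)
  also have "\<dots> = (\<integral>\<^sup>+x. \<integral>\<^sup>+y. k (x, y) * indicator A x \<partial>M2 \<partial>M1)"
    by (subst M2.nn_integral_fst[symmetric]) auto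
  also have "\<dots> = emeasure (density M1 (\<lambda>x. \<integral>\<^sup>+y. k (x, y) \<partial>M2)) A"
    by (auto simp: emeasure_density nn_integral_multc intro!: nn_integral_cong)
  finally show "emeasure (distr (density (M1 \<Otimes>\<^sub>M M2) k) M1 fst) A = \<dots>" .
qed simp

lemma (in pair_prob_space) distr_snd_density:
  assumes [measurable]: "k \<in> borel_measurable (M1 \<Otimes>\<^sub>M M2)"
  shows "distr (density (M1 \<Otimes>\<^sub>M M2) k) M2 snd = density M2 (\<lambda>y. \<integral>\<^sup>+x. k (x, y) \<partial>M1)"
proof (rule measure_eqI)
  fix A assume "A \<in> sets (distr (density (M1 \<Otimes>\<^sub>M M2) k) M2 snd)"
  then have [measurable]: "A \<in> sets M2" by simp
  have "emeasure (distr (density (M1 \<Otimes>\<^sub>M M2) k) M2 snd) A =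
      (\<integral>\<^sup>+z. k z * indicator A (snd z) \<partial>(M1 \<Otimes>\<^sub>M M2))"
    by (subst emeasure_distr)
      (auto simp: emeasure_density indicator_def intro!: nn_integral_cong)
  also have "\<dots> = (\<integral>\<^sup>+y. \<integral>\<^sup>+x. k (x, y) * indicator A y \<partial>M1 \<partial>M2)"
    by (subst nn_integral_snd[symmetric]) auto
  also have "\<dots> = emeasure (density M2 (\<lambda>y. \<integral>\<^sup>+x. k (x, y) \<partial>M1)) A"
    by (auto simp: emeasure_density nn_integral_multc intro!: nn_integral_cong)
  finally show "emeasure (distr (density (M1 \<Otimes>\<^sub>M M2) k) M2 snd) A = \<dots>" .
qed simp

text \<open>Where the integral defining \<open>g\<close> diverges, Bochner's convention makes it \<open>0\<close> and \<open>ln 0 = 0\<close> turns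
  \<open>g\<close> into \<open>0\<close> instead of \<open>-\<infinity>\<close>; this happens on a null set only.\<close>
lemma log_integral_half_step:
  fixes c :: "'a \<Rightarrow> 'b \<Rightarrow> real"
  assumes "prob_space M" "prob_space N"
    and [measurable]: "case_prod c \<in> borel_measurable (M \<Otimes>\<^sub>M N)" "f \<in> borel_measurable M"
    and fin: "AE y in N. (\<integral>\<^sup>+x. ennreal (exp (f x - c x y)) \<partial>M) < \<infinity>"
  defines "g \<equiv> \<lambda>y. - ln (\<integral>x. exp (f x - c x y) \<partial>M)"
  shows "g \<in> borel_measurable N"
    and "AE y in N. (\<integral>\<^sup>+x. ennreal (exp (f x - c x y)) \<partial>M) = ennreal (exp (- g y))"
    and "AE x in M. (\<integral>\<^sup>+y. ennreal (exp (g y - c x y)) \<partial>N) < \<infinity>"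
proof -
  interpret M: prob_space M by fact
  interpret N: prob_space N by fact
  interpret pair_prob_space M N ..
  show g[measurable]: "g \<in> borel_measurable N"
    unfolding g_def by measurable
  have eq: "(\<integral>\<^sup>+x. ennreal (exp (f x - c x y)) \<partial>M) = ennreal (exp (- g y))"
    if "(\<integral>\<^sup>+x. ennreal (exp (f x - c x y)) \<partial>M) < \<infinity>" and [simp]: "y \<in> space N" for y
  proof -
    have int: "integrable M (\<lambda>x. exp (f x - c x y))"
      using that by (intro integrableI_nonneg) (auto intro: le_less_trans)
    have "0 < (\<integral>x. exp (f x - c x y) \<partial>M)"
      using int by (rule M.integral_less_AE_space[of "\<lambda>x. 0", simplified]) (auto simp: M.emeasure_space_1)
    then have "exp (- g y) = (\<integral>x. exp (f x - c x y) \<partial>M)"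
      by (simp add: g_def)
    then show ?thesis
      using int by (simp add: nn_integral_eq_integral)
  qed
  show eqAE: "AE y in N. (\<integral>\<^sup>+x. ennreal (exp (f x - c x y)) \<partial>M) = ennreal (exp (- g y))"
    using fin AE_space by eventually_elim (rule eq)
  have "(\<integral>\<^sup>+x. ennreal (exp (f x)) * (\<integral>\<^sup>+y. ennreal (exp (g y - c x y)) \<partial>N) \<partial>M)
    = (\<integral>\<^sup>+x. (\<integral>\<^sup>+y. ennreal (exp (f x + g y - c x y)) \<partial>N) \<partial>M)"
    by (auto intro!: nn_integral_cong simp flip: nn_integral_cmult ennreal_mult exp_add simp: algebra_simps)
  also have "\<dots> = (\<integral>\<^sup>+y. (\<integral>\<^sup>+x. ennreal (exp (f x + g y - c x y)) \<partial>M) \<partial>N)"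
    by (rule Fubini'[symmetric]) measurable
  also have "\<dots> = (\<integral>\<^sup>+y. ennreal (exp (g y)) * (\<integral>\<^sup>+x. ennreal (exp (f x - c x y)) \<partial>M) \<partial>N)"
    by (auto intro!: nn_integral_cong simp flip: nn_integral_cmult ennreal_mult exp_add simp: algebra_simps)
  also have "\<dots> = (\<integral>\<^sup>+y. 1 \<partial>N)"
    by (rule nn_integral_cong_AE) (use eqAE in \<open>auto simp flip: ennreal_mult exp_add elim!: eventually_mono\<close>)
  also have "\<dots> = 1"
    by (simp add: N.emeasure_space_1)
  finally have "AE x in M. ennreal (exp (f x)) * (\<integral>\<^sup>+y. ennreal (exp (g y - c x y)) \<partial>N) \<noteq> \<infinity>"
    by (intro nn_integral_PInf_AE) auto
  then show "AE x in M. (\<integral>\<^sup>+y. ennreal (exp (g y - c x y)) \<partial>N) < \<infinity>"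
    by eventually_elim (auto simp: less_top[symmetric] ennreal_mult_eq_top_iff)
qed

subsection \<open>A weighted Pinsker inequality\<close>

text \<open>The power series of the remainder starts at degree 2, and
  \<open>\<tau> ^ n \<le> \<tau>\<^sup>2\<close> for every \<open>n \<ge> 2\<close>; the terms are
  compared one by one.\<close>

lemma exp_remainder_scaling:
  fixes x \<tau> :: real
  assumes "0 \<le> \<tau>" "\<tau> \<le> 1"
  shows "exp (\<tau> * x) - 1 - \<tau> * x \<le> \<tau>\<^sup>2 * (exp \<bar>x\<bar> - 1 - \<bar>x\<bar>)"
proof -
  have sums: "(\<lambda>n. y ^ (n + 2) / fact (n + 2)) sums (exp y - 1 - y)" for y :: real
    using exp_converges[of y]
    by (subst sums_iff_shift) (simp add: divide_inverse mult.commute numeral_2_eq_2)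
  show ?thesis
  proof (rule sums_le[OF _ sums sums_mult[OF sums]])
    fix n
    have "\<tau> ^ n \<le> 1"
      using assms by (simp add: power_le_one)
    then have "\<tau> ^ (n + 2) \<le> \<tau>\<^sup>2"
      using assms mult_right_mono[of "\<tau> ^ n" 1 "\<tau>\<^sup>2"] by (simp only: power_add) simp
    moreover have "x ^ (n + 2) \<le> \<bar>x\<bar> ^ (n + 2)"
      by (metis abs_ge_self power_abs)
    ultimately have "\<tau> ^ (n + 2) * x ^ (n + 2) \<le> \<tau>\<^sup>2 * \<bar>x\<bar> ^ (n + 2)"
      using assms by (meson mult_left_mono mult_right_mono order_trans zero_le_power abs_ge_zero)
    then show "(\<tau> * x) ^ (n + 2) / fact (n + 2) \<le> \<tau>\<^sup>2 * (\<bar>x\<bar> ^ (n + 2) / fact (n + 2))"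
      by (simp only: power_mult_distrib times_divide_eq_right) (intro divide_right_mono, auto)
  qed
qed

text \<open>For \<open>s \<le> 1\<close> the remainder is at most its value \<open>exp 1 - 2\<close>
  at 1. For \<open>s > 1\<close>, \<open>r - L = s + L * (s - 1) \<ge> s\<close>. The point is that
  \<open>exp (\<bar>w\<bar> - L)\<close> has mean at most 1 in the application.\<close>

lemma exp_remainder_le:
  fixes L r :: real
  assumes "0 \<le> L" "0 \<le> r"
  defines "s \<equiv> r / (1 + L)"
  shows "exp s - 1 - s \<le> exp 1 - 2 + exp (r - L)"
proof (cases "s \<le> 1")
  case True
  have s: "0 \<le> s" using assms by simp
  have "exp (s * 1) - 1 - s * 1 \<le> s\<^sup>2 * (exp \<bar>1\<bar> - 1 - \<bar>1\<bar>)"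
    using s True by (rule exp_remainder_scaling)
  also have "\<dots> \<le> exp 1 - 2"
    using s True exp_ge_add_one_self[of "1::real"]
      mult_right_mono[of "s\<^sup>2" 1 "exp 1 - 2"]
    by (simp add: power_le_one)
  finally show ?thesis
    by (simp add: add_increasing2)
next
  case False
  have "r = s * (1 + L)"
    using assms by (simp add: s_def)
  then have "s \<le> r - L"
    using False assms(1) mult_left_mono[of 1 s L] by (simp add: algebra_simps)
  then have "exp s \<le> exp (r - L)" by simp
  with False exp_ge_add_one_self[of "1::real"] show ?thesis
    by linarith
qed

text \<open>Young's inequality for \<open>\<rho> ln \<rho> - \<rho> + 1\<close> at \<open>\<rho> = exp u\<close>, applied to \<open>\<tau> w / (1 + L)\<close>. The scale \<open>1 + L\<close> keeps
  the exponential moment bounded, so that the constant is linear in \<open>L\<close>; \<open>\<tau> = min 1 (sqrt \<delta>)\<close> optimises.\<close>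
lemma (in prob_space) weighted_Pinsker:
  fixes u w :: "'a \<Rightarrow> real"
  assumes [measurable]: "u \<in> borel_measurable M" "w \<in> borel_measurable M"
    and expu: "integrable M (\<lambda>x. exp (u x))" "(\<integral>x. exp (u x) \<partial>M) = 1"
    and ent: "integrable M (\<lambda>x. u x * exp (u x))"
    and expw: "integrable M (\<lambda>x. exp \<bar>w x\<bar>)" and L: "(\<integral>x. exp \<bar>w x\<bar> \<partial>M) \<le> exp L" "0 \<le> L"
  defines "\<delta> \<equiv> \<integral>x. u x * exp (u x) \<partial>M"
  shows "integrable M (\<lambda>x. w x * exp (u x))"
    and "(\<integral>x. w x * (exp (u x) - 1) \<partial>M) \<le> 3 * (1 + L) * max \<delta> (sqrt \<delta>)"
proof -
  \<comment> \<open>\<open>B \<tau>\<close> is an integrable majorant of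
    \<open>\<tau> * w * (exp u - 1) / (1 + L)\<close>: its entropy part integrates to
    \<open>\<delta>\<close>, the rest to at most \<open>2 * \<tau>\<^sup>2\<close>.\<close>
  define B where "B \<tau> x = u x * exp (u x) - exp (u x) + 1 + \<tau>\<^sup>2 * (exp 1 - 2 + exp (\<bar>w x\<bar> - L))" for \<tau> x
  have exp_diff_eq: "exp (\<bar>w x\<bar> - L) = exp (- L) * exp \<bar>w x\<bar>" for x
    by (simp flip: exp_add)
  have intB: "integrable M (B \<tau>)" for \<tau>
    unfolding B_def exp_diff_eq using expu ent expw by simp
  \<comment> \<open>Using \<open>r = w\<close> and \<open>r = - w\<close> bounds the product from
    both sides, which yields its integrability.\<close>
  have young: "\<tau> / (1 + L) * (r * (exp (u x) - 1)) \<le> B \<tau> x"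
    if \<tau>: "0 \<le> \<tau>" "\<tau> \<le> 1" and r: "\<bar>r\<bar> = \<bar>w x\<bar>" for \<tau> r x
  proof -
    define s where "s = \<tau> * (r / (1 + L))"
    have "s * (exp (u x) - 1) \<le> (u x * exp (u x) - exp (u x) + 1) + (exp s - 1 - s)"
    proof -
      have "exp (u x) * (1 + (s - u x)) \<le> exp (u x) * exp (s - u x)"
        by (intro mult_left_mono exp_ge_add_one_self) auto
      also have "\<dots> = exp s"
        by (simp flip: exp_add)
      finally show ?thesis
        by (simp add: algebra_simps)
    qed
    moreover have "exp s - 1 - s \<le> \<tau>\<^sup>2 * (exp (\<bar>w x\<bar> / (1 + L)) - 1 - \<bar>w x\<bar> / (1 + L))"
      using exp_remainder_scaling[OF \<tau>, of "r / (1 + L)"] L(2) r by (simp add: s_def)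
    moreover have "\<tau>\<^sup>2 * (exp (\<bar>w x\<bar> / (1 + L)) - 1 - \<bar>w x\<bar> / (1 + L)) \<le> \<tau>\<^sup>2 * (exp 1 - 2 + exp (\<bar>w x\<bar> - L))"
      by (intro mult_left_mono exp_remainder_le) (use L in auto)
    ultimately show ?thesis
      unfolding B_def by (simp add: s_def)
  qed
  have intw: "integrable M w"
  proof (rule Bochner_Integration.integrable_bound[OF expw])
    show "AE x in M. norm (w x) \<le> norm (exp \<bar>w x\<bar>)"
      by (intro AE_I2, simp) (meson abs_ge_zero exp_ge_add_one_self le_add_same_cancel2 order_trans zero_le_one)
  qed simp
  have intd: "integrable M (\<lambda>x. w x * (exp (u x) - 1))"
  proof (rule integrable_sandwich)
    show "integrable M (\<lambda>x. - ((1 + L) * B 1 x))" "integrable M (\<lambda>x. (1 + L) * B 1 x)"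
      using intB by auto
    fix x
    show "w x * (exp (u x) - 1) \<le> (1 + L) * B 1 x" "- ((1 + L) * B 1 x) \<le> w x * (exp (u x) - 1)"
      using young[of 1 "w x" x] young[of 1 "- w x" x] L(2) by (auto simp: field_simps)
  qed simp
  from Bochner_Integration.integrable_add[OF intd intw]
  show "integrable M (\<lambda>x. w x * exp (u x))"
    by (simp add: algebra_simps)
  define D where "D = (\<integral>x. w x * (exp (u x) - 1) \<partial>M)"
  have main: "\<tau> * D \<le> (1 + L) * (\<delta> + 2 * \<tau>\<^sup>2)" if \<tau>: "0 \<le> \<tau>" "\<tau> \<le> 1" for \<tau>
  proof -
    have "\<tau> / (1 + L) * D = (\<integral>x. \<tau> / (1 + L) * (w x * (exp (u x) - 1)) \<partial>M)"
      by (simp add: D_def)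
    also have "\<dots> \<le> (\<integral>x. B \<tau> x \<partial>M)"
      by (intro integral_mono Bochner_Integration.integrable_mult_right intd intB young \<tau>) auto
    also have "\<dots> = \<delta> + \<tau>\<^sup>2 * (exp 1 - 2 + exp (- L) * (\<integral>x. exp \<bar>w x\<bar> \<partial>M))"
      unfolding B_def exp_diff_eq \<delta>_def using expu ent expw by (simp add: prob_space)
    also have "\<dots> \<le> \<delta> + \<tau>\<^sup>2 * 2"
    proof (intro add_left_mono mult_left_mono)
      have "exp (- L) * (\<integral>x. exp \<bar>w x\<bar> \<partial>M) \<le> exp (- L) * exp L"
        using L by (intro mult_left_mono) auto
      also have "\<dots> = 1" by (simp flip: exp_add)
      finally show "exp 1 - 2 + exp (- L) * (\<integral>x. exp \<bar>w x\<bar> \<partial>M) \<le> 2"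
        using exp_le by linarith
    qed simp
    finally show ?thesis
      using L(2) by (simp add: field_simps)
  qed
  have "0 \<le> \<delta> + 2 * 0\<^sup>2"
    using main[of 0] L(2) by (simp add: zero_le_mult_iff)
  then have "0 \<le> \<delta>" by simp
  \<comment> \<open>The choice \<open>\<tau> = sqrt \<delta>\<close> is used for
    \<open>0 < \<delta> \<le> 1\<close>, and \<open>\<tau> = 1\<close> with
    \<open>\<delta> + 2 \<le> 3 * \<delta>\<close> beyond. For \<open>\<delta> = 0\<close> no
    positive \<open>\<tau>\<close> is optimal, and \<open>\<tau>\<close> tends to 0 instead.\<close>
  consider "\<delta> = 0" | "0 < \<delta>" "\<delta> \<le> 1" | "1 < \<delta>"
    using \<open>0 \<le> \<delta>\<close> by linarith
  then have "D \<le> 3 * (1 + L) * max \<delta> (sqrt \<delta>)"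
  proof cases
    case 1
    have "D \<le> 0"
    proof (rule field_le_epsilon)
      fix e :: real assume "0 < e"
      define \<tau> where "\<tau> = min 1 (e / (2 * (1 + L)))"
      have \<tau>: "0 < \<tau>" "\<tau> \<le> 1" "\<tau> \<le> e / (2 * (1 + L))"
        using \<open>0 < e\<close> L(2) by (auto simp: \<tau>_def)
      have "\<tau> * D \<le> \<tau> * (2 * (1 + L) * \<tau>)"
        using main[of \<tau>] \<tau> 1 by (simp add: power2_eq_square algebra_simps)
      then have "D \<le> 2 * (1 + L) * \<tau>"
        using \<tau> by simp
      also have "\<dots> \<le> e"
        using \<tau>(3) L(2) by (simp add: field_simps)
      finally show "D \<le> 0 + e" by simp
    qed
    with 1 show ?thesis by simp
  next
    case 2
    have "sqrt \<delta> * D \<le> (1 + L) * ((sqrt \<delta>)\<^sup>2 + 2 * (sqrt \<delta>)\<^sup>2)"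
      using main[of "sqrt \<delta>"] 2 by simp
    also have "\<dots> = sqrt \<delta> * (3 * (1 + L) * sqrt \<delta>)"
      by algebra
    finally have "D \<le> 3 * (1 + L) * sqrt \<delta>"
      using 2 by (subst (asm) mult_le_cancel_left_pos) auto
    also have "\<dots> \<le> 3 * (1 + L) * max \<delta> (sqrt \<delta>)"
      using L(2) by (intro mult_left_mono) auto
    finally show ?thesis .
  next
    case 3
    have "D \<le> (1 + L) * (\<delta> + 2)"
      using main[of 1] by simp
    also have "\<dots> \<le> (1 + L) * (3 * max \<delta> (sqrt \<delta>))"
      using 3 L(2) by (intro mult_left_mono) auto
    finally show ?thesis
      by (simp add: algebra_simps)
  qed
  then show "(\<integral>x. w x * (exp (u x) - 1) \<partial>M) \<le> 3 * (1 + L) * max \<delta> (sqrt \<delta>)"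
    by (simp add: D_def)
qed

subsection \<open>The entropy recursion\<close>

lemma eln_ereal: "0 < x \<Longrightarrow> eln (ereal x) = ereal (ln x)"
  by (simp add: eln_def)

text \<open>A discrete form of \<open>y' = - k\<^sup>2 y\<^sup>2\<close>. Since
  \<open>1/b - 1/a = (a - b) / (a b)\<close>, it suffices that
  \<open>k\<^sup>2 a b \<le> 2 (a - b)\<close>: if \<open>a \<le> 2 b\<close> this follows from the
  drop hypothesis, otherwise from \<open>k\<^sup>2 a \<le> 1/2\<close> and
  \<open>b < a - b\<close>.\<close>

lemma sublinear_rate_step:
  fixes a b k :: real
  assumes "0 < b" "k\<^sup>2 * b\<^sup>2 \<le> a - b" "2 * (k\<^sup>2 * a) \<le> 1"
  shows "inverse a + k\<^sup>2 / 2 \<le> inverse b"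
proof -
  have "0 \<le> k\<^sup>2 * b\<^sup>2" by simp
  with assms have "0 < a" by linarith
  have "k\<^sup>2 * a * b \<le> 2 * (a - b)"
  proof (cases "a \<le> 2 * b")
    case True
    have "k\<^sup>2 * b * a \<le> k\<^sup>2 * b * (2 * b)"
      using assms True by (intro mult_left_mono) auto
    with assms(2) show ?thesis
      by (simp add: power2_eq_square algebra_simps)
  next
    case False
    have "k\<^sup>2 * a * b \<le> b / 2"
      using mult_right_mono[OF assms(3), of b] assms(1) by (simp add: mult.assoc)
    also have "\<dots> \<le> 2 * (a - b)"
      using False assms(1) by (simp add: not_le)
    finally show ?thesis .
  qed
  with \<open>0 < a\<close> \<open>0 < b\<close> show ?thesis
    by (simp add: field_simps)
qed

text \<open>The inequalities between entropies from which all rates follow, free of measure theory.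
  \<open>H\<close> stands for \<open>H(\<pi>*|R)\<close>; \<open>d\<close> is extended-real because
  \<open>d 0\<close> may be infinite.\<close>

locale entropy_recursion =
  fixes h :: "nat \<Rightarrow> real" and d :: "nat \<Rightarrow> ereal" and C H :: real
  assumes h_nonneg: "0 \<le> h t" and h_0: "h 0 \<le> H" and C_nonneg: "0 \<le> C"
    and d_nonneg: "0 \<le> d t"
    and d_Suc: "d (Suc t) \<le> ereal (h t - h (Suc t))"
    and d_decreasing: "d (Suc t) \<le> d t"
    and h_bound: "d (Suc t) = ereal x \<Longrightarrow> h (Suc t) \<le> 3/2 * C * max x (sqrt x)"
begin

lemma d_SucE: obtains x where "d (Suc t) = ereal x" "0 \<le> x" "x \<le> h t - h (Suc t)"
  using d_Suc[of t] d_nonneg[of "Suc t"] by (cases "d (Suc t)") auto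

lemma h_Suc_le: "h (Suc t) \<le> h t"
  by (rule d_SucE[of t]) auto

lemma h_le_H: "h t \<le> H"
proof (induction t)
  case (Suc t)
  with h_Suc_le[of t] show ?case by simp
qed (rule h_0)

lemma H_nonneg: "0 \<le> H"
  using h_nonneg[of 0] h_0 by simp

lemma d_antimono: "s \<le> t \<Longrightarrow> d t \<le> d s"
  by (rule lift_Suc_antimono_le) (use d_decreasing in auto)

text \<open>Every step into a time before \<open>n\<close> lowers \<open>h\<close> by at least
  \<open>d (Suc t) > 1\<close>. Strictness needs at least one such step.\<close>

lemma h_drop:
  assumes "\<And>t. t < n \<Longrightarrow> 1 < d t" "i \<le> j" "j < n"
  shows "real (j - i) \<le> h i - h j" and "i < j \<Longrightarrow> real (j - i) < h i - h j"
proof -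
  have step: "1 < h t - h (Suc t)" if "Suc t < n" for t
    using assms(1)[OF that] by (rule_tac d_SucE[of t]) auto
  have "real (j - i) \<le> h i - h j \<and> (i < j \<longrightarrow> real (j - i) < h i - h j)"
    using assms(2,3)
  proof (induction j rule: dec_induct)
    case (step j)
    with \<open>Suc j < n \<Longrightarrow> 1 < h j - h (Suc j)\<close> show ?case
      by (auto simp: Suc_diff_le)
  qed simp
  then show "real (j - i) \<le> h i - h j" "i < j \<Longrightarrow> real (j - i) < h i - h j"
    by auto
qed

text \<open>Otherwise \<open>h\<close> would lose 1 per step forever and become negative.\<close>

lemma ex_d_le_1: "\<exists>t. d t \<le> 1"
proof (rule ccontr)
  assume *: "\<nexists>t. d t \<le> 1"
  define n where "n = Suc (nat \<lceil>h 0\<rceil>)"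
  have "real n \<le> h 0 - h n"
    using h_drop(1)[of "Suc n" 0 n] * by (auto simp: not_le)
  moreover have "h 0 < real n"
    unfolding n_def by linarith
  ultimately show False
    using h_nonneg[of n] by simp
qed

text \<open>This is \<open>t\<^sub>0\<close> of the theorem as a natural number;
  \<open>Inf_d_le_1\<close> identifies it with the infimum in \<open>enat\<close>.\<close>

definition n0 :: nat where "n0 = (LEAST t. d t \<le> 1)"

lemma d_before: "t < n0 \<Longrightarrow> 1 < d t"
  using not_less_Least[of t "\<lambda>t. d t \<le> 1"] by (simp add: n0_def not_le)

lemma d_after: "n0 \<le> t \<Longrightarrow> d t \<le> 1"
  using LeastI_ex[OF ex_d_le_1] d_antimono[of n0 t] by (auto simp flip: n0_def)

lemma Inf_d_le_1: "Inf (enat ` {t. d t \<le> 1}) = enat n0"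
proof (rule antisym)
  show "Inf (enat ` {t. d t \<le> 1}) \<le> enat n0"
    using d_after[of n0] by (intro Inf_lower) auto
  show "enat n0 \<le> Inf (enat ` {t. d t \<le> 1})"
    using d_before by (intro Inf_greatest) (force simp: not_le[symmetric])
qed

text \<open>All times up to \<open>n0 - 1\<close> have \<open>d > 1\<close>, so \<open>h\<close>
  drops by more than \<open>n0 - 1\<close> between 0 and \<open>n0 - 1\<close> and still ends
  nonnegative.\<close>

lemma n0_lt: "2 \<le> n0 \<Longrightarrow> real (n0 - 1) < h 0"
  using h_drop(2)[of n0 0 "n0 - 1"] d_before h_nonneg[of "n0 - 1"] by force

text \<open>In \<open>ereal\<close>, \<open>inverse 0 = \<infinity>\<close>, which is the required
  convention for \<open>H = 0\<close> and likewise for \<open>C = 0\<close>.\<close>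

definition kappa :: ereal where
  "kappa = min (inverse (ereal (3/2 * C))) (inverse (ereal (sqrt (2 * H))))"

text \<open>If \<open>C\<close> and \<open>H\<close> both vanish, then
  \<open>0 \<le> h t \<le> H = 0\<close>. Otherwise \<open>kappa = 1 / m\<close> for the larger
  \<open>m\<close> of \<open>3/2 * C\<close> and \<open>sqrt (2 * H)\<close>.\<close>

lemma kappa_cases:
  obtains (inf) "kappa = \<infinity>" "H = 0" "\<And>t. h t = 0"
  | (fin) k where "kappa = ereal k" "0 < k" "3/2 * C * k \<le> 1" "2 * (k\<^sup>2 * H) \<le> 1"
      "inverse (k\<^sup>2) \<le> 5/2 * max (C\<^sup>2) H"
proof (cases "C = 0 \<and> H = 0")
  case True
  show ?thesis
  proof (rule inf)
    show "h t = 0" for t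
      using h_le_H[of t] h_nonneg[of t] True by simp
    show "kappa = \<infinity>"
      unfolding kappa_def using True by simp
  qed (use True in simp)
next
  case False
  define m where "m = max (3/2 * C) (sqrt (2 * H))"
  have "0 < m"
    using False C_nonneg H_nonneg by (auto simp: m_def less_max_iff_disj)
  show ?thesis
  proof (rule fin)
    show "kappa = ereal (inverse m)"
      using False C_nonneg H_nonneg \<open>0 < m\<close>
      by (auto simp: kappa_def m_def min_def max_def inverse_eq_divide field_simps)
    show "0 < inverse m" using \<open>0 < m\<close> by simp
    show "3/2 * C * inverse m \<le> 1"
      using \<open>0 < m\<close> by (simp add: field_simps m_def)
    have "2 * H = (sqrt (2 * H))\<^sup>2"
      using H_nonneg by simp
    also have "\<dots> \<le> m\<^sup>2"
      by (intro power_mono) (auto simp: m_def H_nonneg)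
    finally show "2 * ((inverse m)\<^sup>2 * H) \<le> 1"
      using \<open>0 < m\<close> by (simp add: field_simps)
    \<comment> \<open>Both 9/4 and 2 are at most 5/2; doubled later, this becomes the constant 5 of
      the last bound.\<close>
    have "m\<^sup>2 = (3/2 * C)\<^sup>2 \<or> m\<^sup>2 = 2 * H"
      using H_nonneg by (auto simp: m_def max_def)
    then have "m\<^sup>2 = 9/4 * C\<^sup>2 \<or> m\<^sup>2 = 2 * H"
      by (auto simp: power_mult_distrib power2_eq_square)
    then show "inverse ((inverse m)\<^sup>2) \<le> 5/2 * max (C\<^sup>2) H"
      using H_nonneg zero_le_power2[of C] by (auto simp: power_inverse)
  qed
qed

text \<open>Above 1 the maximum in \<open>h_bound\<close> is \<open>d\<close> itself, so
  \<open>k * h (Suc t) \<le> d (Suc t) \<le> h t - h (Suc t)\<close>.\<close>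

lemma linear_step:
  assumes "1 < d (Suc t)" "0 < k" "3/2 * C * k \<le> 1"
  shows "h (Suc t) * (1 + k) \<le> h t"
proof -
  obtain x where x: "d (Suc t) = ereal x" "0 \<le> x" "x \<le> h t - h (Suc t)"
    by (rule d_SucE)
  with assms(1) have "1 < x" by simp
  then have "sqrt x \<le> x"
    using real_sqrt_le_mono[of 1 x] mult_left_mono[of 1 "sqrt x" "sqrt x"] by simp
  then have "h (Suc t) \<le> 3/2 * C * x"
    using h_bound[OF x(1)] by (simp add: max_def)
  then have "h (Suc t) * k \<le> 3/2 * C * x * k"
    using assms(2) by (intro mult_right_mono) auto
  also have "\<dots> \<le> 1 * x"
    using mult_right_mono[OF assms(3) x(2)] by (simp add: algebra_simps)
  finally show ?thesis
    using x(3) by (simp add: algebra_simps)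
qed

text \<open>Below 1 the maximum in \<open>h_bound\<close> is the square root; squaring gives
  \<open>k\<^sup>2 * (h (Suc t))\<^sup>2 \<le> d (Suc t)\<close>, which is at most the drop of
  \<open>h\<close>.\<close>

lemma sublinear_step:
  assumes "d (Suc t) \<le> 1" "0 < k" "3/2 * C * k \<le> 1" "2 * (k\<^sup>2 * H) \<le> 1" "0 < h (Suc t)"
  shows "inverse (h t) + k\<^sup>2 / 2 \<le> inverse (h (Suc t))"
proof (rule sublinear_rate_step)
  obtain x where x: "d (Suc t) = ereal x" "0 \<le> x" "x \<le> h t - h (Suc t)"
    by (rule d_SucE)
  with assms(1) have "x \<le> 1" by simp
  then have "x \<le> sqrt x"
    using x(2) real_sqrt_le_mono[of x 1] mult_left_mono[of "sqrt x" 1 "sqrt x"] by simp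
  then have "h (Suc t) \<le> 3/2 * C * sqrt x"
    using h_bound[OF x(1)] by (simp add: max_def split: if_splits)
  then have "k * h (Suc t) \<le> k * (3/2 * C * sqrt x)"
    using assms(2) by (intro mult_left_mono) auto
  also have "\<dots> \<le> 1 * sqrt x"
    using mult_right_mono[OF assms(3), of "sqrt x"] x(2) by (simp add: algebra_simps)
  finally have "(k * h (Suc t))\<^sup>2 \<le> (sqrt x)\<^sup>2"
    using assms(2) h_nonneg by (intro power_mono) auto
  then show "k\<^sup>2 * (h (Suc t))\<^sup>2 \<le> h t - h (Suc t)"
    using x by (simp add: power_mult_distrib)
  have "k\<^sup>2 * h t \<le> k\<^sup>2 * H"
    using h_le_H by (intro mult_left_mono) auto
  then show "2 * (k\<^sup>2 * h t) \<le> 1"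
    using assms(4) by simp
qed (rule assms)

lemma linear_rate:
  assumes "0 < k" "3/2 * C * k \<le> 1" "t < n0"
  shows "h t \<le> h 0 / (1 + k) ^ t"
  using assms(3)
proof (induction t)
  case (Suc t)
  have "h (Suc t) * (1 + k) \<le> h t"
    using assms Suc.prems d_before by (intro linear_step) auto
  also have "h t \<le> h 0 / (1 + k) ^ t"
    using Suc by simp
  finally have "h (Suc t) \<le> h 0 / (1 + k) ^ t / (1 + k)"
    using assms(1) by (subst pos_le_divide_eq) auto
  then show ?case
    by (simp only: power_Suc2 divide_divide_eq_left)
qed simp

text \<open>The one-step gains telescope. The step from \<open>s\<close> needs
  \<open>d (Suc s) \<le> 1\<close> and not \<open>d s \<le> 1\<close>, so the regime starts at
  \<open>n0 - 1\<close>; hence the shift from \<open>t\<^sub>0\<close> to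
  \<open>t\<^sub>1\<close>.\<close>

lemma sublinear_rate:
  assumes "0 < k" "3/2 * C * k \<le> 1" "2 * (k\<^sup>2 * H) \<le> 1" "n0 \<le> Suc s" "0 < h (s + m)"
  shows "inverse (h s) + k\<^sup>2 / 2 * real m \<le> inverse (h (s + m))"
  using assms(5)
proof (induction m)
  case (Suc m)
  have "0 < h (s + m)"
    using Suc.prems h_Suc_le[of "s + m"] by simp
  then have "inverse (h s) + k\<^sup>2 / 2 * real m \<le> inverse (h (s + m))"
    by (rule Suc.IH)
  moreover have "inverse (h (s + m)) + k\<^sup>2 / 2 \<le> inverse (h (Suc (s + m)))"
    using assms Suc.prems d_after[of "Suc (s + m)"] by (intro sublinear_step) auto
  ultimately show ?case
    by (simp add: algebra_simps add_divide_distrib)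
qed simp

text \<open>Up to time \<open>t div 2\<close> the linear rate is used, and from then on the drop by more than 1 per step.\<close>
lemma n0_le_t3:
  assumes "2 \<le> n0"
    and t: "eln (2 * ereal (h 0)) \<le> ereal (real (t div 2)) * eln (1 + kappa) + eln (ereal (real t))"
  shows "n0 \<le> t"
proof (rule ccontr)
  assume "\<not> n0 \<le> t"
  then have "t < n0" by simp
  have h0: "1 < h 0"
    using n0_lt assms(1) by simp
  show False
  proof (cases rule: kappa_cases)
    case inf
    with h0 show False by simp
  next
    case (fin k)
    \<comment> \<open>At \<open>t = 0\<close> the right side of the hypothesis is
      \<open>-\<infinity>\<close>, since \<open>eln 0 = -\<infinity>\<close>, while the left side is
      finite.\<close>
    have t0: "t \<noteq> 0"
      using t h0 fin(1) by (auto simp: eln_def one_ereal_def split: if_splits)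
    define m where "m = t div 2"
    have "real (t - m) < h m - h t"
      using t0 \<open>t < n0\<close> d_before by (intro h_drop(2)) (auto simp: m_def)
    also have "\<dots> \<le> h m"
      using h_nonneg by simp
    also have "\<dots> \<le> h 0 / (1 + k) ^ m"
      using fin \<open>t < n0\<close> by (intro linear_rate) (auto simp: m_def)
    finally have *: "real (t - m) * (1 + k) ^ m < h 0"
      using fin(2) by (simp add: field_simps)
    \<comment> \<open>Only the second half of the time interval is counted in the drop, which costs
      the factor 2 in front of \<open>h 0\<close>.\<close>
    have "real t \<le> 2 * real (t - m)"
      unfolding m_def by linarith
    then have "real t * (1 + k) ^ m \<le> 2 * real (t - m) * (1 + k) ^ m"
      using fin(2) by (intro mult_right_mono) auto
    with * have **: "real t * (1 + k) ^ m < 2 * h 0"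
      by simp
    have "eln (2 * ereal (h 0)) = ereal (ln (2 * h 0))"
      using h0 eln_ereal[of "2 * h 0"] by simp
    moreover have "eln (1 + kappa) = ereal (ln (1 + k))"
      using fin(1,2) eln_ereal[of "1 + k"] by (simp add: one_ereal_def)
    moreover have "eln (ereal (real t)) = ereal (ln (real t))"
      using t0 by (intro eln_ereal) simp
    ultimately have "ln (2 * h 0) \<le> real m * ln (1 + k) + ln (real t)"
      using t by (simp add: m_def)
    also have "\<dots> = ln (real t * (1 + k) ^ m)"
      using fin(2) t0 by (simp add: ln_mult ln_realpow)
    finally show False
      using ** h0 fin(2) t0 by (simp add: ln_le_cancel_iff)
  qed
qed

text \<open>The full statement at the level of the recursion. \<open>G\<close> will be
  \<open>H(\<pi>\<^sub>0|R)\<close>, so that \<open>t\<^sub>2\<close> becomes the ceiling of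
  \<open>h 0\<close>.\<close>

lemma convergence_rates:
  fixes G :: real
  assumes G: "H - G = h 0"
  defines "\<kappa> \<equiv> kappa" and "t1 \<equiv> Inf (enat ` {t. d t \<le> 1}) - 1"
  shows "ereal_of_enat t1 \<le> max 0 (min (ereal (of_int \<lceil>H - G\<rceil>))
      (ereal_of_enat (Inf (enat ` {t::nat. eln (2 * ereal (h 0))
         \<le> ereal (real (t div 2)) * eln (1 + \<kappa>) + eln (ereal (real t))}))) - 1)" (is ?A)
    and "enat t < t1 \<Longrightarrow> ereal (h t) \<le> ereal (h 0) * inverse ((1 + \<kappa>) ^ t) \<and>
           ereal (h 0) * inverse ((1 + \<kappa>) ^ t) \<le> ereal H * inverse ((1 + \<kappa>) ^ t)" (is "_ \<Longrightarrow> ?B t")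
    and "t1 \<le> enat t \<Longrightarrow>
           (let s = the_enat t1 in
             ereal (h t)
               \<le> inverse (inverse (ereal (h s)) + ereal (1/2) * \<kappa>\<^sup>2 * ereal (real (t - s))) \<and>
             inverse (inverse (ereal (h s)) + ereal (1/2) * \<kappa>\<^sup>2 * ereal (real (t - s)))
               \<le> inverse (inverse (ereal H) + ereal (1/2) * \<kappa>\<^sup>2 * ereal (real (t - s))) \<and>
             inverse (inverse (ereal H) + ereal (1/2) * \<kappa>\<^sup>2 * ereal (real (t - s)))
               \<le> (if t = s then \<infinity> else ereal (5 * max (C\<^sup>2) H / real (t - s))))"
      (is "_ \<Longrightarrow> ?C t")
proof -
  \<comment> \<open>Subtraction truncates at 0 in \<open>enat\<close> and \<open>nat\<close> alike,
    which provides the maximum with 0 in \<open>t\<^sub>1\<close>.\<close>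
  have t1: "t1 = enat (n0 - 1)"
    unfolding t1_def Inf_d_le_1 by (simp only: one_enat_def idiff_enat_enat)
  show ?A
  proof (cases "2 \<le> n0")
    case False
    then have "t1 = 0"
      by (simp add: t1 enat_0_iff)
    then show ?thesis by simp
  next
    case True
    let ?t3 = "Inf (enat ` {t::nat. eln (2 * ereal (h 0))
         \<le> ereal (real (t div 2)) * eln (1 + \<kappa>) + eln (ereal (real t))})"
    have "enat n0 \<le> ?t3"
    proof (rule Inf_greatest)
      fix e assume "e \<in> enat ` {t::nat. eln (2 * ereal (h 0))
         \<le> ereal (real (t div 2)) * eln (1 + \<kappa>) + eln (ereal (real t))}"
      then obtain t where e: "e = enat t" and t: "eln (2 * ereal (h 0))
         \<le> ereal (real (t div 2)) * eln (1 + kappa) + eln (ereal (real t))"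
        unfolding \<kappa>_def by (elim imageE CollectE)
      have "n0 \<le> t"
        by (rule n0_le_t3[OF True t])
      then show "enat n0 \<le> e"
        by (simp only: e enat_ord_simps)
    qed
    then have "ereal_of_enat (enat n0) \<le> ereal_of_enat ?t3"
      by (simp only: ereal_of_enat_le_iff)
    then have "ereal (real n0) \<le> ereal_of_enat ?t3"
      by (simp only: ereal_of_enat_simps)
    moreover have "real n0 \<le> of_int \<lceil>H - G\<rceil>"
    proof -
      \<comment> \<open>The strict bound \<open>n0 - 1 < h 0\<close> gains a whole unit after
        rounding up, since \<open>n0\<close> is an integer.\<close>
      have "int n0 - 1 < \<lceil>h 0\<rceil>"
        using n0_lt[OF True] True by (simp add: less_ceiling_iff of_nat_diff)
      then have "int n0 \<le> \<lceil>H - G\<rceil>"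
        unfolding G by simp
      then show ?thesis
        by linarith
    qed
    ultimately have "ereal (real n0) - 1 \<le> min (ereal (of_int \<lceil>H - G\<rceil>)) (ereal_of_enat ?t3) - 1"
      by (intro ereal_minus_mono) auto
    moreover have "ereal_of_enat t1 = ereal (real n0) - 1"
      using True by (simp add: t1 one_ereal_def of_nat_diff)
    ultimately show ?thesis
      by (simp add: max.coboundedI2)
  qed
  show "?B t" if "enat t < t1"
  proof
    have t: "t < n0" "2 \<le> n0"
      using that by (auto simp: t1)
    show "ereal (h 0) * inverse ((1 + \<kappa>) ^ t) \<le> ereal H * inverse ((1 + \<kappa>) ^ t)"
    proof (rule ereal_mult_right_mono)
      have "0 \<le> 1 + \<kappa>"
        by (rule kappa_cases) (auto simp: \<kappa>_def one_ereal_def)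
      then show "0 \<le> inverse ((1 + \<kappa>) ^ t)"
        by (intro inverse_ereal_ge0I zero_le_power_ereal)
    qed (use h_0 in simp)
    show "ereal (h t) \<le> ereal (h 0) * inverse ((1 + \<kappa>) ^ t)"
    proof (cases rule: kappa_cases)
      \<comment> \<open>This case is void: \<open>2 \<le> n0\<close> forces
        \<open>h 0 > 0\<close>.\<close>
      case inf
      with n0_lt t show ?thesis by simp
    next
      case (fin k)
      have "1 + \<kappa> = ereal (1 + k)"
        by (simp add: \<kappa>_def fin(1) one_ereal_def)
      then have "inverse ((1 + \<kappa>) ^ t) = ereal (inverse ((1 + k) ^ t))"
        using fin(2) by simp
      moreover have "h t \<le> h 0 * inverse ((1 + k) ^ t)"
        using linear_rate[OF fin(2,3) t(1)] by (simp only: divide_inverse)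
      ultimately show ?thesis
        by simp
    qed
  qed
  show "?C t" if "t1 \<le> enat t"
  proof -
    define s where "s = n0 - 1"
    define m where "m = t - s"
    have t: "t = s + m" and n0: "n0 \<le> Suc s"
      using that by (auto simp: t1 s_def m_def)
    have "ereal (h t)
           \<le> inverse (inverse (ereal (h s)) + ereal (1/2) * \<kappa>\<^sup>2 * ereal (real m)) \<and>
         inverse (inverse (ereal (h s)) + ereal (1/2) * \<kappa>\<^sup>2 * ereal (real m))
           \<le> inverse (inverse (ereal H) + ereal (1/2) * \<kappa>\<^sup>2 * ereal (real m)) \<and>
         inverse (inverse (ereal H) + ereal (1/2) * \<kappa>\<^sup>2 * ereal (real m))
           \<le> (if m = 0 then \<infinity> else ereal (5 * max (C\<^sup>2) H / real m))"
    proof (cases rule: kappa_cases)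
      \<comment> \<open>All entropies vanish here; \<open>inverse 0 = \<infinity>\<close> and
        \<open>inverse \<infinity> = 0\<close> make the first two bounds 0.\<close>
      case inf
      then show ?thesis
        by (cases "m = 0") (simp_all add: \<kappa>_def power2_eq_square)
    next
      case (fin k)
      define a where "a = k\<^sup>2 / 2 * real m"
      have "0 \<le> a" by (simp add: a_def)
      have a: "ereal (1/2) * \<kappa>\<^sup>2 * ereal (real m) = ereal a"
        by (simp add: \<kappa>_def fin(1) a_def)
      \<comment> \<open>This form stays correct at \<open>r = 0\<close>, where both sides are 0 by
        the conventions of \<open>ereal\<close>.\<close>
      have inv_eq: "inverse (inverse (ereal r) + ereal a) = ereal (r / (1 + a * r))" if "0 \<le> r" for r
      proof (cases "r = 0")
        case False
        with that have "0 < r" by simp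
        with \<open>0 \<le> a\<close> have "0 < 1 + a * r"
          by (simp add: add_pos_nonneg)
        moreover have "inverse r + a = (1 + a * r) / r"
          using \<open>0 < r\<close> by (simp add: field_simps)
        ultimately show ?thesis
          using \<open>0 < r\<close> by simp
      qed simp
      have mono: "x / (1 + a * x) \<le> y / (1 + a * y)" if "0 \<le> x" "x \<le> y" for x y
      proof -
        have "0 < 1 + a * x" "0 < 1 + a * y"
          using that \<open>0 \<le> a\<close> by (simp_all add: add_pos_nonneg)
        then show ?thesis
          using that by (simp add: frac_le_eq divide_le_0_iff) (simp add: algebra_simps)
      qed
      have 1: "h t \<le> h s / (1 + a * h s)"
      proof (cases "h t = 0")
        case True
        then show ?thesis
          using h_nonneg[of s] \<open>0 \<le> a\<close> by simp
      next
        case False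
        then have pos: "0 < h (s + m)"
          using h_nonneg[of t] by (simp add: t)
        have "h (s + m) \<le> h s"
          by (rule lift_Suc_antimono_le[of h]) (auto intro: h_Suc_le)
        with pos have "0 < h s" by simp
        with \<open>0 \<le> a\<close> have "0 < 1 + a * h s"
          by (simp add: add_pos_nonneg)
        have "inverse (h s) + a \<le> inverse (h (s + m))"
          unfolding a_def by (rule sublinear_rate[OF fin(2-4) n0 pos])
        then have "(inverse (h s) + a) * (h s * h (s + m)) \<le> inverse (h (s + m)) * (h s * h (s + m))"
          using pos \<open>0 < h s\<close> by (intro mult_right_mono) auto
        moreover have "(inverse (h s) + a) * (h s * h (s + m)) = h (s + m) * (1 + a * h s)"
          using \<open>0 < h s\<close> by (simp add: field_simps)
        ultimately have "h (s + m) * (1 + a * h s) \<le> h s"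
          using pos by (simp add: field_simps)
        with \<open>0 < 1 + a * h s\<close> show ?thesis
          by (simp add: pos_le_divide_eq t)
      qed
      have 2: "h s / (1 + a * h s) \<le> H / (1 + a * H)"
        by (rule mono[OF h_nonneg h_le_H])
      have 3: "H / (1 + a * H) \<le> 5 * max (C\<^sup>2) H / real m" if "m \<noteq> 0"
      proof -
        have "0 < a" using fin(2) that by (simp add: a_def)
        have "0 < 1 + a * H"
          using \<open>0 < a\<close> H_nonneg by (simp add: add_pos_nonneg)
        moreover have "inverse a * (1 + a * H) = inverse a + H"
          using \<open>0 < a\<close> by (simp add: field_simps)
        ultimately have "H / (1 + a * H) \<le> inverse a"
          using \<open>0 < a\<close> by (simp only: pos_divide_le_eq) simp
        also have "\<dots> = 2 * inverse (k\<^sup>2) / real m"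
          by (simp add: a_def field_simps)
        also have "\<dots> \<le> 5 * max (C\<^sup>2) H / real m"
          using fin(5) by (intro divide_right_mono) auto
        finally show ?thesis .
      qed
      show ?thesis
        unfolding a inv_eq[OF h_nonneg] inv_eq[OF H_nonneg] using 1 2 3 by simp
    qed
    moreover have "the_enat t1 = s" "m = 0 \<longleftrightarrow> t = s"
      by (simp_all add: t1 s_def t)
    ultimately show ?thesis
      unfolding Let_def by (simp only: m_def)
  qed
qed

end

subsection \<open>Gibbs measures and their marginals\<close>

locale cost_setting = pair_prob_space \<mu> \<nu>
  for \<mu> :: "'a measure" and \<nu> :: "'b measure" +
  fixes c :: "'a \<Rightarrow> 'b \<Rightarrow> real"
  assumes cost_measurable [measurable]: "case_prod c \<in> borel_measurable (\<mu> \<Otimes>\<^sub>M \<nu>)"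
begin

text \<open>The common form of \<open>\<pi>*\<close>, of the iterates of both parities and of
  \<open>R\<close>. Total mass 1 is not built in and is proved case by case.\<close>

definition gibbs :: "('a \<Rightarrow> real) \<Rightarrow> ('b \<Rightarrow> real) \<Rightarrow> ('a \<times> 'b) measure" where
  "gibbs f g = density (\<mu> \<Otimes>\<^sub>M \<nu>) (\<lambda>(x, y). ennreal (exp (f x + g y - c x y)))"

lemma sets_gibbs [measurable_cong, simp]: "sets (gibbs f g) = sets (\<mu> \<Otimes>\<^sub>M \<nu>)"
  by (simp add: gibbs_def)

lemma space_gibbs [simp]: "space (gibbs f g) = space \<mu> \<times> space \<nu>"
  by (simp add: gibbs_def space_pair_measure)

text \<open>The cost cancels from the ratio, so the relative log-density is a sum of functions of
  one variable each.\<close>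

lemma gibbs_eq_density:
  assumes [measurable]: "f \<in> borel_measurable \<mu>" "f' \<in> borel_measurable \<mu>"
    "g \<in> borel_measurable \<nu>" "g' \<in> borel_measurable \<nu>"
  shows "gibbs f' g' =
    density (gibbs f g) (\<lambda>z. ennreal (exp (f' (fst z) - f (fst z) + (g' (snd z) - g (snd z)))))"
  unfolding gibbs_def
  by (subst density_density_eq)
    (auto intro!: density_cong simp: algebra_simps simp flip: ennreal_mult exp_add)

text \<open>\<open>p\<close> is the update of the first potential for given \<open>g\<close>; the
  marginal is \<open>\<mu>\<close> when \<open>f = p\<close>.\<close>

lemma distr_fst_gibbs:
  assumes [measurable]: "f \<in> borel_measurable \<mu>" "g \<in> borel_measurable \<nu>" "p \<in> borel_measurable \<mu>"
    and eq: "AE x in \<mu>. (\<integral>\<^sup>+y. ennreal (exp (g y - c x y)) \<partial>\<nu>) = ennreal (exp (- p x))"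
  shows "distr (gibbs f g) \<mu> fst = density \<mu> (\<lambda>x. ennreal (exp (f x - p x)))"
proof -
  have "distr (gibbs f g) \<mu> fst = density \<mu> (\<lambda>x. \<integral>\<^sup>+y. ennreal (exp (f x + g y - c x y)) \<partial>\<nu>)"
    unfolding gibbs_def by (subst distr_fst_density) auto
  also have "\<dots> = density \<mu> (\<lambda>x. ennreal (exp (f x - p x)))"
  proof (rule density_cong)
    show "AE x in \<mu>. (\<integral>\<^sup>+y. ennreal (exp (f x + g y - c x y)) \<partial>\<nu>) = ennreal (exp (f x - p x))"
      using eq AE_space
    proof eventually_elim
      case (elim x)
      have "(\<integral>\<^sup>+y. ennreal (exp (f x + g y - c x y)) \<partial>\<nu>)
          = (\<integral>\<^sup>+y. ennreal (exp (f x)) * ennreal (exp (g y - c x y)) \<partial>\<nu>)"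
        by (auto intro!: nn_integral_cong simp: algebra_simps simp flip: ennreal_mult exp_add)
      also have "\<dots> = ennreal (exp (f x - p x))"
        using elim by (subst nn_integral_cmult) (auto simp flip: ennreal_mult exp_add)
      finally show ?case .
    qed
  qed auto
  finally show ?thesis .
qed

lemma distr_snd_gibbs:
  assumes [measurable]: "f \<in> borel_measurable \<mu>" "g \<in> borel_measurable \<nu>" "q \<in> borel_measurable \<nu>"
    and eq: "AE y in \<nu>. (\<integral>\<^sup>+x. ennreal (exp (f x - c x y)) \<partial>\<mu>) = ennreal (exp (- q y))"
  shows "distr (gibbs f g) \<nu> snd = density \<nu> (\<lambda>y. ennreal (exp (g y - q y)))"
proof -
  have "distr (gibbs f g) \<nu> snd = density \<nu> (\<lambda>y. \<integral>\<^sup>+x. ennreal (exp (f x + g y - c x y)) \<partial>\<mu>)"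
    unfolding gibbs_def by (subst distr_snd_density) auto
  also have "\<dots> = density \<nu> (\<lambda>y. ennreal (exp (g y - q y)))"
  proof (rule density_cong)
    show "AE y in \<nu>. (\<integral>\<^sup>+x. ennreal (exp (f x + g y - c x y)) \<partial>\<mu>) = ennreal (exp (g y - q y))"
      using eq AE_space
    proof eventually_elim
      case (elim y)
      have "(\<integral>\<^sup>+x. ennreal (exp (f x + g y - c x y)) \<partial>\<mu>)
          = (\<integral>\<^sup>+x. ennreal (exp (g y)) * ennreal (exp (f x - c x y)) \<partial>\<mu>)"
        by (auto intro!: nn_integral_cong simp: algebra_simps simp flip: ennreal_mult exp_add)
      also have "\<dots> = ennreal (exp (g y - q y))"
        using elim by (subst nn_integral_cmult) (auto simp flip: ennreal_mult exp_add)
      finally show ?case .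
    qed
  qed auto
  finally show ?thesis .
qed

lemma prob_space_gibbs_fst:
  assumes "prob_space (distr (gibbs f g) \<mu> fst)"
  shows "prob_space (gibbs f g)"
  by (rule prob_space_distrD[OF _ assms]) simp

lemma prob_space_gibbs_snd:
  assumes "prob_space (distr (gibbs f g) \<nu> snd)"
  shows "prob_space (gibbs f g)"
  by (rule prob_space_distrD[OF _ assms]) simp

lemma integrable_gibbs_fst:
  assumes "distr (gibbs f g) \<mu> fst = \<mu>'" and [measurable]: "u \<in> borel_measurable \<mu>"
  shows "integrable (gibbs f g) (\<lambda>z. u (fst z)) \<longleftrightarrow> integrable \<mu>' (u :: 'a \<Rightarrow> real)"
    and "(\<integral>z. u (fst z) \<partial>gibbs f g) = (\<integral>x. u x \<partial>\<mu>')"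
  unfolding assms(1)[symmetric] by (simp_all add: integrable_distr_eq integral_distr)

lemma integrable_gibbs_snd:
  assumes "distr (gibbs f g) \<nu> snd = \<nu>'" and [measurable]: "v \<in> borel_measurable \<nu>"
  shows "integrable (gibbs f g) (\<lambda>z. v (snd z)) \<longleftrightarrow> integrable \<nu>' (v :: 'b \<Rightarrow> real)"
    and "(\<integral>z. v (snd z) \<partial>gibbs f g) = (\<integral>y. v y \<partial>\<nu>')"
  unfolding assms(1)[symmetric] by (simp_all add: integrable_distr_eq integral_distr)

text \<open>\<open>exp (- k)\<close> is the density of \<open>gibbs f' g'\<close> with respect to
  \<open>gibbs f g\<close>, so it integrates to 1 and \<open>exp_neg_mean_le_1\<close>
  applies.\<close>

lemma gibbs_relative_entropy_nonneg:
  assumes [measurable]: "f \<in> borel_measurable \<mu>" "f' \<in> borel_measurable \<mu>"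
    "g \<in> borel_measurable \<nu>" "g' \<in> borel_measurable \<nu>"
    and "prob_space (gibbs f g)" "prob_space (gibbs f' g')"
  defines "k \<equiv> \<lambda>z. f (fst z) - f' (fst z) + (g (snd z) - g' (snd z))"
  shows "integrable (gibbs f g) (\<lambda>z. max 0 (- k z))"
    and "integrable (gibbs f g) k \<Longrightarrow> 0 \<le> (\<integral>z. k z \<partial>gibbs f g)"
proof -
  interpret G: prob_space "gibbs f g" by fact
  interpret G': prob_space "gibbs f' g'" by fact
  have [measurable]: "k \<in> borel_measurable (gibbs f g)"
    unfolding k_def by measurable
  have "(\<integral>\<^sup>+z. ennreal (exp (- k z)) \<partial>gibbs f g) = emeasure (gibbs f' g') (space (gibbs f' g'))"
    by (subst (1 2) gibbs_eq_density[of f f' g g'])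
      (auto simp: emeasure_density k_def algebra_simps intro!: nn_integral_cong)
  then have "(\<integral>\<^sup>+z. ennreal (exp (- k z)) \<partial>gibbs f g) \<le> 1"
    by (simp add: G'.emeasure_space_1 del: space_gibbs)
  from G.exp_neg_mean_le_1[OF _ this]
  show "integrable (gibbs f g) (\<lambda>z. max 0 (- k z))"
    and "integrable (gibbs f g) k \<Longrightarrow> 0 \<le> (\<integral>z. k z \<partial>gibbs f g)"
    by auto
qed

lemma rel_ent_gibbs:
  assumes [measurable]: "f \<in> borel_measurable \<mu>" "f' \<in> borel_measurable \<mu>"
    "g \<in> borel_measurable \<nu>" "g' \<in> borel_measurable \<nu>"
    and "prob_space (gibbs f g)"
    and "integrable (gibbs f' g') (\<lambda>z. f' (fst z) - f (fst z))"
    and "integrable (gibbs f' g') (\<lambda>z. g' (snd z) - g (snd z))"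
  shows "rel_ent (gibbs f' g') (gibbs f g) =
    ereal ((\<integral>z. f' (fst z) - f (fst z) \<partial>gibbs f' g') + (\<integral>z. g' (snd z) - g (snd z) \<partial>gibbs f' g'))"
proof -
  interpret G: prob_space "gibbs f g" by fact
  have "rel_ent (gibbs f' g') (gibbs f g) =
    ereal (\<integral>z. f' (fst z) - f (fst z) + (g' (snd z) - g (snd z)) \<partial>gibbs f' g')"
    using rel_ent_density_exp[of "gibbs f g" "\<lambda>z. f' (fst z) - f (fst z) + (g' (snd z) - g (snd z))"]
      G.sigma_finite_measure_axioms assms(6,7)
    by (simp flip: gibbs_eq_density)
  with assms(6,7) show ?thesis
    by simp
qed

end

subsection \<open>Entropies along the Sinkhorn iteration\<close>

text \<open>Optimality of \<open>\<pi>*\<close> is represented by its Gibbs form, its marginals and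
  the integrability of the sum of its potentials, which is later derived from finiteness of the
  optimal cost.\<close>

locale sinkhorn_setting = cost_setting \<mu> \<nu> c
  for \<mu> :: "'a measure" and \<nu> :: "'b measure" and c +
  fixes \<phi>s :: "'a \<Rightarrow> real" and \<psi>s :: "'b \<Rightarrow> real"
  assumes integrable_exp_cost: "integrable (\<mu> \<Otimes>\<^sub>M \<nu>) (\<lambda>(x, y). exp (- c x y))"
    and phis_measurable [measurable]: "\<phi>s \<in> borel_measurable \<mu>"
    and psis_measurable [measurable]: "\<psi>s \<in> borel_measurable \<nu>"
    and distr_fst_opt: "distr (gibbs \<phi>s \<psi>s) \<mu> fst = \<mu>"
    and distr_snd_opt: "distr (gibbs \<phi>s \<psi>s) \<nu> snd = \<nu>"
    and integrable_potentials: "integrable (gibbs \<phi>s \<psi>s) (\<lambda>z. \<phi>s (fst z) + \<psi>s (snd z))"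
    and C1_finite: "sk_C1 \<mu> \<nu> c \<phi>s < \<infinity>"
begin

abbreviation \<phi> where "\<phi> \<equiv> sk_phi \<mu> \<nu> c"
abbreviation \<psi> where "\<psi> \<equiv> sk_psi \<mu> \<nu> c"
abbreviation \<xi> where "\<xi> \<equiv> sk_xi \<mu> \<nu> c"
abbreviation \<pi>s where "\<pi>s \<equiv> gibbs \<phi>s \<psi>s"

text \<open>The index is shifted: \<open>psi_prev t\<close> is \<open>\<psi>\<^bsub>t-1\<^esub>\<close>, starting from \<open>\<psi>\<^bsub>-1\<^esub> = - ln \<xi>\<close>.\<close>
definition psi_prev :: "nat \<Rightarrow> 'b \<Rightarrow> real" where
  "psi_prev t = (case t of 0 \<Rightarrow> \<lambda>_. - ln \<xi> | Suc s \<Rightarrow> \<psi> s)"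

text \<open>The logarithm of \<open>d\<mu>\<^sub>2\<^sub>t/d\<mu>\<close>.\<close>

definition u :: "nat \<Rightarrow> 'a \<Rightarrow> real" where
  "u t x = \<phi> t x - \<phi> (Suc t) x"

lemma phi_0: "\<phi> 0 = (\<lambda>_. 0)"
  by (simp add: sk_phi_def)

text \<open>The invariant of the induction is almost everywhere finiteness of the next normalising
  integral; each half step hands it over to the other variable. It starts from integrability of
  \<open>exp (- c)\<close>, as \<open>\<phi> 0 = 0\<close>.\<close>

lemma iterates:
  shows phi_measurable: "\<phi> t \<in> borel_measurable \<mu>"
    and psi_measurable: "\<psi> t \<in> borel_measurable \<nu>"
    and psi_transform: "AE y in \<nu>. (\<integral>\<^sup>+x. ennreal (exp (\<phi> t x - c x y)) \<partial>\<mu>) = ennreal (exp (- \<psi> t y))"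
    and phi_transform: "AE x in \<mu>. (\<integral>\<^sup>+y. ennreal (exp (\<psi> t y - c x y)) \<partial>\<nu>) = ennreal (exp (- \<phi> (Suc t) x))"
proof -
  note half_psi = log_integral_half_step[OF M1.prob_space_axioms M2.prob_space_axioms cost_measurable]
  have "case_prod (\<lambda>y x. c x y) \<in> borel_measurable (\<nu> \<Otimes>\<^sub>M \<mu>)"
    by measurable
  note half_phi = log_integral_half_step[OF M2.prob_space_axioms M1.prob_space_axioms this]
  have phi_Suc: "\<phi> (Suc t) = (\<lambda>x. - ln (\<integral>y. exp (\<psi> t y - c x y) \<partial>\<nu>))" for t
    by (simp add: sk_phi_def sk_psi_def Let_def)
  have psi_eq: "\<psi> t = (\<lambda>y. - ln (\<integral>x. exp (\<phi> t x - c x y) \<partial>\<mu>))" for t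
    by (cases t) (simp_all add: sk_phi_def sk_psi_def Let_def)
  have *: "\<phi> t \<in> borel_measurable \<mu> \<and> (AE y in \<nu>. (\<integral>\<^sup>+x. ennreal (exp (\<phi> t x - c x y)) \<partial>\<mu>) < \<infinity>)" for t
  proof (induction t)
    case 0
    have "(\<integral>\<^sup>+y. \<integral>\<^sup>+x. ennreal (exp (- c x y)) \<partial>\<mu> \<partial>\<nu>) = (\<integral>\<^sup>+z. ennreal (case z of (x, y) \<Rightarrow> exp (- c x y)) \<partial>(\<mu> \<Otimes>\<^sub>M \<nu>))"
      by (subst nn_integral_snd[symmetric]) auto
    also have "\<dots> \<noteq> \<infinity>"
      using integrable_exp_cost by (simp add: nn_integral_eq_integral split: prod.split)
    finally have "AE y in \<nu>. (\<integral>\<^sup>+x. ennreal (exp (- c x y)) \<partial>\<mu>) \<noteq> \<infinity>"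
      by (intro nn_integral_PInf_AE) auto
    then show ?case
      by (auto simp: sk_phi_def less_top)
  next
    case (Suc t)
    then have "\<phi> t \<in> borel_measurable \<mu>" "AE y in \<nu>. (\<integral>\<^sup>+x. ennreal (exp (\<phi> t x - c x y)) \<partial>\<mu>) < \<infinity>"
      by auto
    note psi = half_psi[OF this]
    have "\<psi> t \<in> borel_measurable \<nu>" "AE x in \<mu>. (\<integral>\<^sup>+y. ennreal (exp (\<psi> t y - c x y)) \<partial>\<nu>) < \<infinity>"
      unfolding psi_eq by (fact psi)+
    note phi = half_phi[OF this]
    show ?case
      unfolding phi_Suc by (intro conjI) (fact phi)+
  qed
  show phi: "\<phi> t \<in> borel_measurable \<mu>" using * by simp
  have fin: "AE y in \<nu>. (\<integral>\<^sup>+x. ennreal (exp (\<phi> t x - c x y)) \<partial>\<mu>) < \<infinity>"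
    using * by simp
  show psi: "\<psi> t \<in> borel_measurable \<nu>"
    unfolding psi_eq by (rule half_psi(1)[OF phi fin])
  show "AE y in \<nu>. (\<integral>\<^sup>+x. ennreal (exp (\<phi> t x - c x y)) \<partial>\<mu>) = ennreal (exp (- \<psi> t y))"
    unfolding psi_eq by (rule half_psi(2)[OF phi fin])
  have "AE x in \<mu>. (\<integral>\<^sup>+y. ennreal (exp (\<psi> t y - c x y)) \<partial>\<nu>) < \<infinity>"
    unfolding psi_eq by (rule half_psi(3)[OF phi fin])
  from half_phi(2)[OF psi this]
  show "AE x in \<mu>. (\<integral>\<^sup>+y. ennreal (exp (\<psi> t y - c x y)) \<partial>\<nu>) = ennreal (exp (- \<phi> (Suc t) x))"
    unfolding phi_Suc .
qed

declare phi_measurable [measurable] psi_measurable [measurable]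

lemma psi_prev_measurable [measurable]: "psi_prev t \<in> borel_measurable \<nu>"
  by (cases t) (simp_all add: psi_prev_def)

lemma u_measurable [measurable]: "u t \<in> borel_measurable \<mu>"
  unfolding u_def by measurable

lemma pi_even_eq: "pi_even \<mu> \<nu> c t = gibbs (\<phi> t) (\<psi> t)"
  by (simp add: pi_even_def gibbs_def)

lemma distr_snd_even: "distr (gibbs (\<phi> t) (\<psi> t)) \<nu> snd = \<nu>"
  by (subst distr_snd_gibbs[OF _ _ _ psi_transform]) (simp_all add: density_1)

lemma mu_even_eq: "mu_even \<mu> \<nu> c t = density \<mu> (\<lambda>x. ennreal (exp (u t x)))"
  unfolding mu_even_def pi_even_eq u_def
  by (rule distr_fst_gibbs[OF _ _ _ phi_transform]) simp_all

lemma distr_fst_even: "distr (gibbs (\<phi> t) (\<psi> t)) \<mu> fst = mu_even \<mu> \<nu> c t"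
  by (simp add: mu_even_def pi_even_eq)

lemma distr_fst_odd: "distr (gibbs (\<phi> (Suc t)) (\<psi> t)) \<mu> fst = \<mu>"
  by (subst distr_fst_gibbs[OF _ _ _ phi_transform]) (simp_all add: density_1)

lemma prob_space_opt: "prob_space \<pi>s"
  by (rule prob_space_gibbs_fst) (simp add: distr_fst_opt M1.prob_space_axioms)

lemma prob_space_even: "prob_space (gibbs (\<phi> t) (\<psi> t))"
  by (rule prob_space_gibbs_snd) (simp add: distr_snd_even M2.prob_space_axioms)

lemma prob_space_mu_even: "prob_space (mu_even \<mu> \<nu> c t)"
  unfolding mu_even_def pi_even_eq
  by (intro prob_space.prob_space_distr prob_space_even) simp

lemma xi_pos: "0 < \<xi>"
proof -
  have "0 < (\<integral>z. (case z of (x, y) \<Rightarrow> exp (- c x y)) \<partial>(\<mu> \<Otimes>\<^sub>M \<nu>))"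
    by (rule integral_less_AE_space[of "\<lambda>x. 0", simplified, OF integrable_exp_cost])
      (auto simp: emeasure_space_1)
  then show ?thesis
    by (simp add: sk_xi_def)
qed

lemma ref_R_eq: "ref_R \<mu> \<nu> c = gibbs (\<phi> 0) (psi_prev 0)"
  using xi_pos
  by (auto simp: ref_R_def gibbs_def phi_0 psi_prev_def exp_diff exp_minus divide_inverse mult.commute
      intro!: density_cong)

lemma prob_space_ref: "prob_space (ref_R \<mu> \<nu> c)"
proof
  have "(\<integral>\<^sup>+z. ennreal (case z of (x, y) \<Rightarrow> exp (- c x y) / \<xi>) \<partial>(\<mu> \<Otimes>\<^sub>M \<nu>)) =
      ennreal (\<integral>z. (case z of (x, y) \<Rightarrow> exp (- c x y)) / \<xi> \<partial>(\<mu> \<Otimes>\<^sub>M \<nu>))"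
    using integrable_exp_cost xi_pos
    by (subst nn_integral_eq_integral[symmetric])
      (auto intro!: nn_integral_cong Bochner_Integration.integrable_divide)
  also have "\<dots> = 1"
    using xi_pos by (simp flip: sk_xi_def)
  finally show "emeasure (ref_R \<mu> \<nu> c) (space (ref_R \<mu> \<nu> c)) = 1"
    by (simp add: ref_R_def emeasure_density split_beta' cong: nn_integral_cong)
qed

lemma prob_space_prev: "prob_space (gibbs (\<phi> t) (psi_prev t))"
proof (cases t)
  case 0
  then show ?thesis
    using prob_space_ref by (simp add: ref_R_eq)
next
  case (Suc s)
  have "prob_space (gibbs (\<phi> (Suc s)) (\<psi> s))"
    by (rule prob_space_gibbs_fst) (simp add: distr_fst_odd M1.prob_space_axioms)
  then show ?thesis
    by (simp add: Suc psi_prev_def)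
qed

text \<open>The infimum over \<open>\<alpha>\<close> need not be attained, hence \<open>K\<close>
  strictly above \<open>sk_C1\<close>. \<open>L\<close> is the logarithm of the exponential moment,
  which is at least 1.\<close>

lemma C1_witness:
  assumes "sk_C1 \<mu> \<nu> c \<phi>s < ereal K"
  obtains \<alpha> L where "0 < \<alpha>" "0 \<le> L" "2 / \<alpha> * (3/2 + L) < K"
    "integrable \<mu> (\<lambda>x. exp (\<alpha> * \<bar>\<phi> t x - \<phi>s x\<bar>))"
    "(\<integral>x. exp (\<alpha> * \<bar>\<phi> t x - \<phi>s x\<bar>) \<partial>\<mu>) \<le> exp L"
proof -
  define I where "I \<alpha> = (\<integral>\<^sup>+x. ennreal (exp (\<alpha> * \<bar>\<phi> t x - \<phi>s x\<bar>)) \<partial>\<mu>)" for \<alpha>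
  have "(INF \<alpha>\<in>{0<..}. ereal (2 / \<alpha>) * (ereal (3/2) + eln (enn2ereal (I \<alpha>)))) < ereal K"
    using assms unfolding sk_C1_def I_def by (rule le_less_trans[OF SUP_upper[OF UNIV_I]])
  then obtain \<alpha> where \<alpha>: "0 < \<alpha>" and less: "ereal (2 / \<alpha>) * (ereal (3/2) + eln (enn2ereal (I \<alpha>))) < ereal K"
    by (auto simp: INF_less_iff)
  have "I \<alpha> \<noteq> \<infinity>"
    using less \<alpha> by (auto simp: eln_def)
  then obtain r where r: "I \<alpha> = ennreal r" "0 \<le> r"
    by (cases "I \<alpha>") auto
  have int: "integrable \<mu> (\<lambda>x. exp (\<alpha> * \<bar>\<phi> t x - \<phi>s x\<bar>))"
    using r by (intro integrableI_nonneg) (auto simp: I_def)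
  have "(\<integral>\<^sup>+x. 1 \<partial>\<mu>) \<le> I \<alpha>"
    unfolding I_def using \<alpha> by (intro nn_integral_mono) simp
  then have "1 \<le> r"
    using r by (simp add: M1.emeasure_space_1)
  show ?thesis
  proof
    show "0 < \<alpha>" by fact
    show "0 \<le> ln r" using \<open>1 \<le> r\<close> by simp
    show "2 / \<alpha> * (3/2 + ln r) < K"
      using less \<open>1 \<le> r\<close> r by (simp add: eln_def enn2ereal_ennreal)
    show "integrable \<mu> (\<lambda>x. exp (\<alpha> * \<bar>\<phi> t x - \<phi>s x\<bar>))" by fact
    show "(\<integral>x. exp (\<alpha> * \<bar>\<phi> t x - \<phi>s x\<bar>) \<partial>\<mu>) \<le> exp (ln r)"
      using \<open>1 \<le> r\<close> r by (subst integral_eq_nn_integral) (auto simp: I_def)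
  qed
qed

lemma C1_eq: "sk_C1 \<mu> \<nu> c \<phi>s = ereal (real_of_ereal (sk_C1 \<mu> \<nu> c \<phi>s))"
  and C1_nonneg: "0 \<le> real_of_ereal (sk_C1 \<mu> \<nu> c \<phi>s)"
proof -
  have "\<not> sk_C1 \<mu> \<nu> c \<phi>s < ereal 0"
  proof
    assume "sk_C1 \<mu> \<nu> c \<phi>s < ereal 0"
    from C1_witness[OF this, of 0] obtain \<alpha> L :: real
      where "0 < \<alpha>" "0 \<le> L" "2 / \<alpha> * (3/2 + L) < 0" by metis
    then show False
      by (auto simp: mult_less_0_iff divide_less_0_iff)
  qed
  then show "sk_C1 \<mu> \<nu> c \<phi>s = ereal (real_of_ereal (sk_C1 \<mu> \<nu> c \<phi>s))"
    and "0 \<le> real_of_ereal (sk_C1 \<mu> \<nu> c \<phi>s)"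
    using C1_finite by (cases "sk_C1 \<mu> \<nu> c \<phi>s"; simp)+
qed

text \<open>A finite exponential moment controls the first moment, by \<open>\<bar>r\<bar> \<le> exp
  (\<alpha> * \<bar>r\<bar>) / \<alpha>\<close>.\<close>

lemma integrable_phi_diff: "integrable \<mu> (\<lambda>x. \<phi> t x - \<phi>s x)"
proof -
  have "sk_C1 \<mu> \<nu> c \<phi>s < ereal (real_of_ereal (sk_C1 \<mu> \<nu> c \<phi>s) + 1)"
    by (subst C1_eq) simp
  from C1_witness[OF this, of t] obtain \<alpha> :: real
    where \<alpha>: "0 < \<alpha>" and int: "integrable \<mu> (\<lambda>x. exp (\<alpha> * \<bar>\<phi> t x - \<phi>s x\<bar>))" by metis
  have le: "\<bar>r\<bar> \<le> exp (\<alpha> * \<bar>r\<bar>) / \<alpha>" for r :: real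
  proof -
    have "\<alpha> * \<bar>r\<bar> \<le> exp (\<alpha> * \<bar>r\<bar>)"
      using exp_ge_add_one_self[of "\<alpha> * \<bar>r\<bar>"] by linarith
    with \<alpha> show ?thesis
      by (simp add: field_simps)
  qed
  show ?thesis
  proof (rule Bochner_Integration.integrable_bound)
    show "integrable \<mu> (\<lambda>x. exp (\<alpha> * \<bar>\<phi> t x - \<phi>s x\<bar>) / \<alpha>)"
      using int by simp
    show "AE x in \<mu>. norm (\<phi> t x - \<phi>s x) \<le> norm (exp (\<alpha> * \<bar>\<phi> t x - \<phi>s x\<bar>) / \<alpha>)"
      using le \<alpha> by (intro AE_I2) simp
  qed simp
qed

text \<open>At \<open>t = 0\<close> the iterate is zero, so \<open>\<phi>s\<close> itself is
  controlled; this separates the two potentials.\<close>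

lemma integrable_phis: "integrable \<mu> \<phi>s"
  using integrable_phi_diff[of 0] by (simp add: phi_0)

lemma integrable_phi: "integrable \<mu> (\<phi> t)"
  using Bochner_Integration.integrable_add[OF integrable_phi_diff[of t] integrable_phis] by simp

lemmas opt_fst = integrable_gibbs_fst[OF distr_fst_opt]
lemmas opt_snd = integrable_gibbs_snd[OF distr_snd_opt]
lemmas even_fst = integrable_gibbs_fst[OF distr_fst_even]
lemmas even_snd = integrable_gibbs_snd[OF distr_snd_even]

lemma integrable_psis: "integrable \<nu> \<psi>s"
proof -
  have "integrable \<pi>s (\<lambda>z. \<phi>s (fst z))"
    by (simp add: opt_fst integrable_phis)
  from Bochner_Integration.integrable_diff[OF integrable_potentials this]
  show ?thesis
    by (simp add: opt_snd)
qed

lemma integrable_psi_step_neg: "integrable \<nu> (\<lambda>y. max 0 (psi_prev t y - \<psi> t y))"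
  using gibbs_relative_entropy_nonneg(1)[OF _ _ _ _ prob_space_even[of t] prob_space_prev[of t]]
    even_snd(1)[of "\<lambda>y. max 0 (psi_prev t y - \<psi> t y)" t]
  by simp

text \<open>\<open>\<psi> t\<close> is squeezed: from below by the previous iterate and the negative
  part just bounded, from above by the negative part of the log-density of \<open>\<pi>*\<close>
  relative to \<open>\<pi>\<^sub>2\<^sub>t\<close>.\<close>

lemma integrable_psi_prev: "integrable \<nu> (psi_prev t)"
proof (induction t)
  case 0
  show ?case by (simp add: psi_prev_def)
next
  case (Suc t)
  define k where "k z = \<phi>s (fst z) - \<phi> t (fst z) + (\<psi>s (snd z) - \<psi> t (snd z))" for z
  have "integrable \<pi>s (\<lambda>z. \<psi> t (snd z))"
  proof (rule integrable_sandwich)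
    have "integrable \<nu> (\<lambda>y. psi_prev t y - max 0 (psi_prev t y - \<psi> t y))"
      using Suc integrable_psi_step_neg by simp
    then show "integrable \<pi>s (\<lambda>z. psi_prev t (snd z) - max 0 (psi_prev t (snd z) - \<psi> t (snd z)))"
      by (subst opt_snd) auto
    have "integrable \<pi>s (\<lambda>z. max 0 (- k z))"
      unfolding k_def
      by (rule gibbs_relative_entropy_nonneg(1)[OF _ _ _ _ prob_space_opt prob_space_even]) measurable
    moreover have "integrable \<pi>s (\<lambda>z. \<psi>s (snd z))" "integrable \<pi>s (\<lambda>z. \<phi>s (fst z))" "integrable \<pi>s (\<lambda>z. \<phi> t (fst z))"
      by (simp_all add: opt_snd opt_fst integrable_psis integrable_phis integrable_phi)
    ultimately show "integrable \<pi>s (\<lambda>z. \<psi>s (snd z) + (\<phi>s (fst z) - \<phi> t (fst z)) + max 0 (- k z))"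
      by simp
  qed (auto simp: k_def max_def)
  then show ?case
    by (simp add: opt_snd psi_prev_def)
qed

lemma integrable_psi: "integrable \<nu> (\<psi> t)"
  using integrable_psi_prev[of "Suc t"] by (simp add: psi_prev_def)

definition h :: "nat \<Rightarrow> real" where
  "h t = (\<integral>x. \<phi>s x - \<phi> t x \<partial>\<mu>) + (\<integral>y. \<psi>s y - \<psi> t y \<partial>\<nu>)"

definition g :: "nat \<Rightarrow> real" where
  "g t = (\<integral>y. \<psi> t y - psi_prev t y \<partial>\<nu>)"

definition H :: real where
  "H = (\<integral>x. \<phi>s x \<partial>\<mu>) + (\<integral>y. \<psi>s y + ln \<xi> \<partial>\<nu>)"

lemmas integrable_potentials_all =
  integrable_phis integrable_phi integrable_psis integrable_psi integrable_psi_prev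

lemma rel_ent_opt_even: "rel_ent \<pi>s (pi_even \<mu> \<nu> c t) = ereal (h t)"
  unfolding pi_even_eq h_def
  by (subst rel_ent_gibbs[OF _ _ _ _ prob_space_even])
    (simp_all add: opt_fst opt_snd integrable_potentials_all)

lemma rel_ent_opt_ref: "rel_ent \<pi>s (ref_R \<mu> \<nu> c) = ereal H"
proof -
  have "prob_space (gibbs (\<phi> 0) (psi_prev 0))" by (rule prob_space_prev)
  then show ?thesis
    unfolding ref_R_eq H_def
    by (subst rel_ent_gibbs)
      (simp_all add: opt_fst opt_snd integrable_potentials_all, simp add: phi_0 psi_prev_def)
qed

lemma rel_ent_even_ref: "rel_ent (pi_even \<mu> \<nu> c 0) (ref_R \<mu> \<nu> c) = ereal (g 0)"
  unfolding ref_R_eq g_def pi_even_eq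
  by (subst rel_ent_gibbs[OF _ _ _ _ prob_space_prev])
    (simp_all add: even_snd integrable_potentials_all)

lemma h_nonneg: "0 \<le> h t"
  using gibbs_relative_entropy_nonneg(2)[OF _ _ _ _ prob_space_opt prob_space_even, of t]
  by (simp add: opt_fst opt_snd integrable_potentials_all h_def)

lemma g_nonneg: "0 \<le> g t"
  using gibbs_relative_entropy_nonneg(2)[OF _ _ _ _ prob_space_even[of t] prob_space_prev[of t]]
  by (simp add: even_snd integrable_potentials_all g_def)

text \<open>A Pythagorean identity: \<open>\<pi>*\<close> and \<open>\<pi>\<^sub>0\<close> share the
  second marginal, and the log-density of \<open>\<pi>\<^sub>0\<close> relative to \<open>R\<close>
  depends on \<open>y\<close> alone.\<close>

lemma H_diff: "H - g 0 = h 0"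
  by (simp add: H_def g_def h_def phi_0 psi_prev_def integrable_potentials_all M2.prob_space)

lemma g_Suc_le: "g (Suc t) \<le> h t - h (Suc t)"
proof -
  note odd_fst = integrable_gibbs_fst[OF distr_fst_odd]
  have "prob_space (gibbs (\<phi> (Suc t)) (\<psi> t))"
    using prob_space_prev[of "Suc t"] by (simp add: psi_prev_def)
  from gibbs_relative_entropy_nonneg(2)[OF _ _ _ _ this prob_space_even[of t]]
  have "(\<integral>x. \<phi> t x \<partial>\<mu>) \<le> (\<integral>x. \<phi> (Suc t) x \<partial>\<mu>)"
    by (simp add: odd_fst integrable_potentials_all)
  then show ?thesis
    by (simp add: g_def h_def psi_prev_def integrable_potentials_all)
qed

section \<open>Entropies of the first marginals\<close>

lemma d_eq: "rel_ent (mu_even \<mu> \<nu> c t) \<mu> =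
    (if integrable (mu_even \<mu> \<nu> c t) (u t) then ereal (\<integral>x. u t x \<partial>mu_even \<mu> \<nu> c t) else \<infinity>)"
  unfolding mu_even_eq
  by (rule rel_ent_density_exp) (simp_all add: M1.sigma_finite_measure_axioms)

lemma u_neg_part: "integrable (mu_even \<mu> \<nu> c t) (\<lambda>x. max 0 (- u t x))"
  and u_integral_nonneg: "integrable (mu_even \<mu> \<nu> c t) (u t) \<Longrightarrow> 0 \<le> (\<integral>x. u t x \<partial>mu_even \<mu> \<nu> c t)"
proof -
  have "prob_space (gibbs (\<phi> (Suc t)) (\<psi> t))"
    using prob_space_prev[of "Suc t"] by (simp add: psi_prev_def)
  note gibbs_relative_entropy_nonneg[OF _ _ _ _ prob_space_even[of t] this]
  then show "integrable (mu_even \<mu> \<nu> c t) (\<lambda>x. max 0 (- u t x))"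
    and "integrable (mu_even \<mu> \<nu> c t) (u t) \<Longrightarrow> 0 \<le> (\<integral>x. u t x \<partial>mu_even \<mu> \<nu> c t)"
    using even_fst[of "u t" t] even_fst(1)[of "\<lambda>x. max 0 (- u t x)" t]
    by (simp_all add: u_def[abs_def])
qed

lemma d_nonneg: "0 \<le> rel_ent (mu_even \<mu> \<nu> c t) \<mu>"
  by (simp add: d_eq u_integral_nonneg)

text \<open>Data processing, by comparing \<open>\<pi>\<^sub>2\<^sub>t\<close> with the reweighting of \<open>\<pi>\<^bsub>2t-1\<^esub>\<close> by \<open>d\<mu>\<^sub>2\<^sub>t/d\<mu>\<close>. This fails for
  \<open>t = 0\<close>, since the first marginal of \<open>R\<close> is not \<open>\<mu>\<close>: the entropy of \<open>\<mu>\<^sub>0\<close> may be infinite.\<close>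
lemma d_Suc_le_g: "rel_ent (mu_even \<mu> \<nu> c (Suc t)) \<mu> \<le> ereal (g (Suc t))"
proof -
  let ?P = "gibbs (\<phi> (Suc t)) (\<psi> (Suc t))"
  define f where "f x = \<phi> (Suc t) x + u (Suc t) x" for x
  have [measurable]: "f \<in> borel_measurable \<mu>"
    unfolding f_def by measurable
  have "distr (gibbs f (\<psi> t)) \<mu> fst = mu_even \<mu> \<nu> c (Suc t)"
    unfolding mu_even_eq
    by (subst distr_fst_gibbs[OF _ _ _ phi_transform]) (simp_all add: f_def)
  then have "prob_space (gibbs f (\<psi> t))"
    by (intro prob_space_gibbs_fst) (simp add: prob_space_mu_even)
  note nonneg = gibbs_relative_entropy_nonneg[OF _ _ _ _ prob_space_even[of "Suc t"] this]
  have v: "integrable ?P (\<lambda>z. \<psi> (Suc t) (snd z))" "integrable ?P (\<lambda>z. \<psi> t (snd z))"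
    by (simp_all add: even_snd integrable_potentials_all)
  \<comment> \<open>The log-density relative to the reweighted measure is the increment of the
    second potential minus \<open>u\<close>, so its negative part bounds \<open>u\<close> from
    above.\<close>
  have u: "integrable ?P (\<lambda>z. u (Suc t) (fst z))"
  proof (rule integrable_sandwich)
    show "integrable ?P (\<lambda>z. - max 0 (- u (Suc t) (fst z)))"
      using u_neg_part[of "Suc t"] even_fst(1)[of "\<lambda>x. max 0 (- u (Suc t) x)" "Suc t"] by simp
    show "integrable ?P (\<lambda>z. max 0 (- (\<phi> (Suc t) (fst z) - f (fst z) + (\<psi> (Suc t) (snd z) - \<psi> t (snd z))))
        + (\<psi> (Suc t) (snd z) - \<psi> t (snd z)))"
      using v by (intro Bochner_Integration.integrable_add Bochner_Integration.integrable_diff nonneg(1)) auto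
  qed (auto simp: f_def)
  then have int: "integrable (mu_even \<mu> \<nu> c (Suc t)) (u (Suc t))"
    by (simp add: even_fst)
  from nonneg(2) u v int show "rel_ent (mu_even \<mu> \<nu> c (Suc t)) \<mu> \<le> ereal (g (Suc t))"
    by (simp add: d_eq f_def even_fst even_snd g_def psi_prev_def integrable_potentials_all)
qed

lemma g_Suc_le_d: "ereal (g (Suc t)) \<le> rel_ent (mu_even \<mu> \<nu> c t) \<mu>"
proof (cases "integrable (mu_even \<mu> \<nu> c t) (u t)")
  case True
  let ?P = "gibbs (\<phi> t) (\<psi> t)"
  have u: "integrable ?P (\<lambda>z. u t (fst z))"
    using True by (simp add: even_fst)
  have v: "integrable ?P (\<lambda>z. \<psi> t (snd z) - \<psi> (Suc t) (snd z))"
    using even_snd(1)[of "\<lambda>y. \<psi> t y - \<psi> (Suc t) y"] by (simp add: integrable_potentials_all)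
  have "0 \<le> (\<integral>z. u t (fst z) + (\<psi> t (snd z) - \<psi> (Suc t) (snd z)) \<partial>?P)"
    using u v unfolding u_def
    by (intro gibbs_relative_entropy_nonneg(2) prob_space_even Bochner_Integration.integrable_add) auto
  also have "\<dots> = (\<integral>x. u t x \<partial>mu_even \<mu> \<nu> c t) + (\<integral>y. \<psi> t y - \<psi> (Suc t) y \<partial>\<nu>)"
    using u v even_snd(2)[of "\<lambda>y. \<psi> t y - \<psi> (Suc t) y" t] by (simp add: even_fst)
  finally show ?thesis
    using True by (simp add: d_eq g_def psi_prev_def integrable_potentials_all)
qed (simp add: d_eq)

text \<open>Adding the reverse entropy to \<open>h t\<close> cancels the second potentials, as both
  measures have second marginal \<open>\<nu>\<close>. The remaining integral is bounded by
  \<open>weighted_Pinsker\<close> for \<open>\<alpha> * w\<close>, and \<open>K\<close> then tends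
  to \<open>?C\<close>.\<close>

lemma h_bound:
  assumes "rel_ent (mu_even \<mu> \<nu> c t) \<mu> = ereal x"
  shows "h t \<le> 3/2 * real_of_ereal (sk_C1 \<mu> \<nu> c \<phi>s) * max x (sqrt x)"
proof -
  let ?C = "real_of_ereal (sk_C1 \<mu> \<nu> c \<phi>s)"
  define m where "m = max x (sqrt x)"
  have "0 \<le> x"
    using d_nonneg[of t] assms by simp
  then have "0 \<le> m" by (simp add: m_def)
  have intu: "integrable (mu_even \<mu> \<nu> c t) (u t)" and x: "x = (\<integral>x. u t x \<partial>mu_even \<mu> \<nu> c t)"
    using assms by (auto simp: d_eq split: if_splits)
  have dens: "integrable (mu_even \<mu> \<nu> c t) f \<longleftrightarrow> integrable \<mu> (\<lambda>x. f x * exp (u t x))"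
    "(\<integral>x. f x \<partial>mu_even \<mu> \<nu> c t) = (\<integral>x. f x * exp (u t x) \<partial>\<mu>)"
    if [measurable]: "f \<in> borel_measurable \<mu>" for f :: "'a \<Rightarrow> real"
    unfolding mu_even_eq by (simp_all add: integrable_density integral_density mult.commute)
  interpret E: prob_space "mu_even \<mu> \<nu> c t" by (rule prob_space_mu_even)
  have intexp: "integrable \<mu> (\<lambda>x. exp (u t x))" "(\<integral>x. exp (u t x) \<partial>\<mu>) = 1"
    using dens[of "\<lambda>_. 1"] E.prob_space by simp_all
  have le: "h t \<le> 3/2 * K * m" if K: "?C < K" for K
  proof -
    have "sk_C1 \<mu> \<nu> c \<phi>s < ereal K"
      using K by (subst C1_eq) simp
    then obtain \<alpha> L where \<alpha>: "0 < \<alpha>" and L: "0 \<le> L"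
      and aL: "2 / \<alpha> * (3/2 + L) < K"
      and int: "integrable \<mu> (\<lambda>x. exp (\<alpha> * \<bar>\<phi> t x - \<phi>s x\<bar>))"
        "(\<integral>x. exp (\<alpha> * \<bar>\<phi> t x - \<phi>s x\<bar>) \<partial>\<mu>) \<le> exp L"
      by (rule C1_witness)
    define w where "w x = \<phi> t x - \<phi>s x" for x
    have [measurable]: "w \<in> borel_measurable \<mu>"
      unfolding w_def by measurable
    have intw: "integrable \<mu> w"
      unfolding w_def[abs_def] by (rule integrable_phi_diff)
    note pinsker = M1.weighted_Pinsker[of "u t" "\<lambda>x. \<alpha> * w x" L]
    have "integrable \<mu> (\<lambda>x. \<alpha> * w x * exp (u t x))"
      using intu int \<alpha> L intexp by (intro pinsker(1)) (auto simp: abs_mult w_def dens)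
    then have intwu: "integrable \<mu> (\<lambda>x. w x * exp (u t x))"
      using \<alpha> by (simp add: mult.assoc)
    have "(\<integral>x. \<alpha> * w x * (exp (u t x) - 1) \<partial>\<mu>) \<le> 3 * (1 + L) * max (\<integral>x. u t x * exp (u t x) \<partial>\<mu>) (sqrt (\<integral>x. u t x * exp (u t x) \<partial>\<mu>))"
      using intu int \<alpha> L intexp by (intro pinsker(2)) (auto simp: abs_mult w_def dens)
    also have "\<dots> = 3 * (1 + L) * m"
      by (simp add: m_def x dens)
    also have "(\<integral>x. \<alpha> * w x * (exp (u t x) - 1) \<partial>\<mu>) = \<alpha> * ((\<integral>x. w x * exp (u t x) \<partial>\<mu>) - (\<integral>x. w x \<partial>\<mu>))"
      using intw intwu by (simp add: mult.assoc right_diff_distrib)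
    finally have 1: "\<alpha> * ((\<integral>x. w x * exp (u t x) \<partial>\<mu>) - (\<integral>x. w x \<partial>\<mu>)) \<le> 3 * (1 + L) * m" .
    have w': "integrable (gibbs (\<phi> t) (\<psi> t)) (\<lambda>z. w (fst z))"
      by (subst even_fst) (auto simp: dens intwu)
    have v': "integrable (gibbs (\<phi> t) (\<psi> t)) (\<lambda>z. \<psi> t (snd z) - \<psi>s (snd z))"
      using even_snd(1)[of "\<lambda>y. \<psi> t y - \<psi>s y"] by (simp add: integrable_potentials_all)
    have "0 \<le> (\<integral>z. w (fst z) + (\<psi> t (snd z) - \<psi>s (snd z)) \<partial>gibbs (\<phi> t) (\<psi> t))"
      using w' v' unfolding w_def
      by (intro gibbs_relative_entropy_nonneg(2) prob_space_even prob_space_opt Bochner_Integration.integrable_add) auto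
    also have "\<dots> = (\<integral>x. w x * exp (u t x) \<partial>\<mu>) + (\<integral>y. \<psi> t y - \<psi>s y \<partial>\<nu>)"
      using w' v' even_snd(2)[of "\<lambda>y. \<psi> t y - \<psi>s y" t] by (simp add: even_fst dens)
    finally have "h t \<le> (\<integral>x. w x * exp (u t x) \<partial>\<mu>) - (\<integral>x. w x \<partial>\<mu>)"
      by (simp add: h_def w_def integrable_potentials_all)
    then have "\<alpha> * h t \<le> \<alpha> * ((\<integral>x. w x * exp (u t x) \<partial>\<mu>) - (\<integral>x. w x \<partial>\<mu>))"
      using \<alpha> by (intro mult_left_mono) auto
    also note 1
    \<comment> \<open>\<open>3 * (1 + L) \<le> 3/2 * (2 * (3/2 + L))\<close>, and the choice of
      \<open>\<alpha>\<close> and \<open>L\<close> bounds the bracket by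
      \<open>\<alpha> * K\<close>.\<close>
    also have "3 * (1 + L) * m \<le> 3/2 * (\<alpha> * K) * m"
    proof (intro mult_right_mono \<open>0 \<le> m\<close>)
      have "2 * (3/2 + L) < \<alpha> * K"
        using aL \<alpha> by (simp add: field_simps)
      then show "3 * (1 + L) \<le> 3/2 * (\<alpha> * K)" by simp
    qed
    finally have "\<alpha> * h t \<le> \<alpha> * (3/2 * K * m)"
      by (simp add: algebra_simps)
    then show ?thesis
      using \<alpha> by simp
  qed
  have "h t \<le> 3/2 * ?C * m"
  proof (rule field_le_epsilon)
    fix e :: real assume "0 < e"
    \<comment> \<open>The summand 1 keeps the denominator positive when
      \<open>m = 0\<close>.\<close>
    define e' where "e' = e / (3/2 * m + 1)"
    have "0 < e'"
      using \<open>0 < e\<close> \<open>0 \<le> m\<close> by (simp add: e'_def)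
    have "h t \<le> 3/2 * (?C + e') * m"
      using \<open>0 < e'\<close> by (intro le) simp
    also have "\<dots> = 3/2 * ?C * m + 3/2 * m * e'"
      by (simp add: algebra_simps)
    also have "3/2 * m * e' \<le> (3/2 * m + 1) * e'"
      using \<open>0 < e'\<close> by (intro mult_right_mono) auto
    also have "\<dots> = e"
      using \<open>0 \<le> m\<close> by (simp add: e'_def)
    finally show "h t \<le> 3/2 * ?C * m + e" by simp
  qed
  then show ?thesis
    by (simp add: m_def)
qed

end

text \<open>Both inequalities for \<open>d (Suc t)\<close> pass through \<open>g (Suc t)\<close>,
  which lies below the drop of \<open>h\<close> and below \<open>d t\<close>.\<close>

lemma (in sinkhorn_setting) entropy_recursion_sinkhorn:
  "entropy_recursion h (\<lambda>t. rel_ent (mu_even \<mu> \<nu> c t) \<mu>) (real_of_ereal (sk_C1 \<mu> \<nu> c \<phi>s)) H"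
proof
  fix t
  show "0 \<le> h t" by (rule h_nonneg)
  show "h 0 \<le> H" using H_diff g_nonneg[of 0] by simp
  show "0 \<le> real_of_ereal (sk_C1 \<mu> \<nu> c \<phi>s)" by (rule C1_nonneg)
  show "0 \<le> rel_ent (mu_even \<mu> \<nu> c t) \<mu>" by (rule d_nonneg)
  show "rel_ent (mu_even \<mu> \<nu> c (Suc t)) \<mu> \<le> ereal (h t - h (Suc t))"
    using d_Suc_le_g g_Suc_le by (meson ereal_less_eq(3) order_trans)
  show "rel_ent (mu_even \<mu> \<nu> c (Suc t)) \<mu> \<le> rel_ent (mu_even \<mu> \<nu> c t) \<mu>"
    using d_Suc_le_g g_Suc_le_d by (rule order_trans)
qed (rule h_bound)

section \<open>From the optimal coupling to the convergence rates\<close>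

theorem theorem4p4:
  fixes \<mu> :: "'a::polish_space measure" and \<nu> :: "'b::polish_space measure"
    and c :: "'a \<Rightarrow> 'b \<Rightarrow> real"
    and \<phi>s :: "'a \<Rightarrow> real" and \<psi>s :: "'b \<Rightarrow> real"
    and \<pi>s :: "('a \<times> 'b) measure"
    and C1 :: real and HR :: ereal and \<kappa> :: ereal
    and t0 t1 t3 :: enat and t2 :: int
  assumes "prob_space \<mu>" and "prob_space \<nu>"
    and "sets \<mu> = sets borel" and "sets \<nu> = sets borel"
    and "case_prod c \<in> borel_measurable (\<mu> \<Otimes>\<^sub>M \<nu>)"
    and "integrable (\<mu> \<Otimes>\<^sub>M \<nu>) (\<lambda>(x, y). exp (- c x y))"
    and "\<bar>INF \<pi>\<in>couplings \<mu> \<nu>. eot_cost \<mu> \<nu> c \<pi>\<bar> \<noteq> \<infinity>"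
    and "\<pi>s \<in> couplings \<mu> \<nu>"
    and "eot_cost \<mu> \<nu> c \<pi>s = (INF \<pi>\<in>couplings \<mu> \<nu>. eot_cost \<mu> \<nu> c \<pi>)"
    and "\<forall>\<pi>\<in>couplings \<mu> \<nu>. eot_cost \<mu> \<nu> c \<pi> = (INF \<pi>'\<in>couplings \<mu> \<nu>. eot_cost \<mu> \<nu> c \<pi>') \<longrightarrow> \<pi> = \<pi>s"
    and "\<phi>s \<in> borel_measurable \<mu>" and "\<psi>s \<in> borel_measurable \<nu>"
    and "\<pi>s = density (\<mu> \<Otimes>\<^sub>M \<nu>) (\<lambda>(x, y). ennreal (exp (\<phi>s x + \<psi>s y - c x y)))"
    and "sk_C1 \<mu> \<nu> c \<phi>s < \<infinity>"
  defines "C1 \<equiv> real_of_ereal (sk_C1 \<mu> \<nu> c \<phi>s)"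
    and "HR \<equiv> rel_ent \<pi>s (ref_R \<mu> \<nu> c)"
    and "\<kappa> \<equiv> min (inverse (ereal (3/2 * C1))) (inverse (ereal (sqrt (2 * real_of_ereal HR))))"
    and "t0 \<equiv> Inf (enat ` {t. rel_ent (mu_even \<mu> \<nu> c t) \<mu> \<le> 1})"
    and "t1 \<equiv> t0 - 1"
    and "t2 \<equiv> \<lceil>real_of_ereal HR - real_of_ereal (rel_ent (pi_even \<mu> \<nu> c 0) (ref_R \<mu> \<nu> c))\<rceil>"
    and "t3 \<equiv> Inf (enat ` {t::nat. ereal (real (t div 2)) * eln (1 + \<kappa>) + eln (ereal (real t))
                                 \<ge> eln (2 * rel_ent \<pi>s (pi_even \<mu> \<nu> c 0))})"
  shows "ereal_of_enat t1 \<le> max 0 (min (ereal (of_int t2)) (ereal_of_enat t3) - 1) \<and>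
     (\<forall>t::nat. enat t < t1 \<longrightarrow>
           rel_ent \<pi>s (pi_even \<mu> \<nu> c t) \<le> rel_ent \<pi>s (pi_even \<mu> \<nu> c 0) * inverse ((1 + \<kappa>) ^ t) \<and>
           rel_ent \<pi>s (pi_even \<mu> \<nu> c 0) * inverse ((1 + \<kappa>) ^ t) \<le> HR * inverse ((1 + \<kappa>) ^ t)) \<and>
     (\<forall>t::nat. t1 \<le> enat t \<longrightarrow>
           (let s = the_enat t1 in
             rel_ent \<pi>s (pi_even \<mu> \<nu> c t)
               \<le> inverse (inverse (rel_ent \<pi>s (pi_even \<mu> \<nu> c s)) + ereal (1/2) * \<kappa>\<^sup>2 * ereal (real (t - s))) \<and>
             inverse (inverse (rel_ent \<pi>s (pi_even \<mu> \<nu> c s)) + ereal (1/2) * \<kappa>\<^sup>2 * ereal (real (t - s)))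
               \<le> inverse (inverse HR + ereal (1/2) * \<kappa>\<^sup>2 * ereal (real (t - s))) \<and>
             inverse (inverse HR + ereal (1/2) * \<kappa>\<^sup>2 * ereal (real (t - s)))
               \<le> (if t = s then \<infinity> else ereal (5 * max (C1\<^sup>2) (real_of_ereal HR) / real (t - s)))))"
proof -
  interpret M: prob_space \<mu> by fact
  interpret N: prob_space \<nu> by fact
  interpret cost_setting \<mu> \<nu> c
    by unfold_locales fact
  have \<pi>s: "\<pi>s = gibbs \<phi>s \<psi>s"
    using assms(13) by (simp add: gibbs_def)
  have fst: "distr (gibbs \<phi>s \<psi>s) \<mu> fst = \<mu>" and snd: "distr (gibbs \<phi>s \<psi>s) \<nu> snd = \<nu>"
    using assms(8) by (auto simp: couplings_def \<pi>s)
  \<comment> \<open>A finite optimal cost rules out both infinite branches: \<open>c\<close> is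
    integrable under \<open>\<pi>s\<close> and the entropy is finite.\<close>
  have cost: "integrable \<pi>s (case_prod c)" and ent: "rel_ent \<pi>s (\<mu> \<Otimes>\<^sub>M \<nu>) \<noteq> \<infinity>"
    using assms(7) unfolding assms(9)[symmetric] by (auto simp: eot_cost_def split: if_splits)
  let ?k = "\<lambda>z. \<phi>s (fst z) + \<psi>s (snd z) - case_prod c z"
  note [measurable] = assms(11,12)
  have k: "\<pi>s = density (\<mu> \<Otimes>\<^sub>M \<nu>) (\<lambda>z. ennreal (exp (?k z)))"
    using assms(13) by (simp add: split_beta')
  \<comment> \<open>The log-density of \<open>\<pi>s\<close> is the sum of its potentials minus
    \<open>c\<close>; finite entropy makes it integrable, and adding \<open>c\<close> back leaves
    the potentials.\<close>
  have "rel_ent \<pi>s (\<mu> \<Otimes>\<^sub>M \<nu>) = (if integrable \<pi>s ?k then ereal (\<integral>z. ?k z \<partial>\<pi>s) else \<infinity>)"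
    unfolding k by (rule rel_ent_density_exp) (unfold_locales, measurable)
  with ent have "integrable \<pi>s ?k"
    by (auto split: if_splits)
  from Bochner_Integration.integrable_add[OF this cost]
  have pot: "integrable (gibbs \<phi>s \<psi>s) (\<lambda>z. \<phi>s (fst z) + \<psi>s (snd z))"
    by (simp add: \<pi>s)
  interpret sinkhorn_setting \<mu> \<nu> c \<phi>s \<psi>s
    by unfold_locales (use assms(6,11,12,14) fst snd pot in auto)
  interpret entropy_recursion h "\<lambda>t. rel_ent (mu_even \<mu> \<nu> c t) \<mu>" C1 H
    unfolding C1_def by (rule entropy_recursion_sinkhorn)
  have HR: "HR = ereal H"
    by (simp add: HR_def \<pi>s rel_ent_opt_ref)
  have \<kappa>: "\<kappa> = kappa"
    by (simp add: \<kappa>_def kappa_def HR)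
  have real_H: "real_of_ereal (ereal H) = H" by simp
  have real_g: "real_of_ereal (ereal (g 0)) = g 0" by simp
  note r = convergence_rates[OF H_diff]
  show ?thesis
    unfolding t1_def t0_def t2_def t3_def \<kappa> \<pi>s rel_ent_opt_even HR rel_ent_even_ref real_H real_g
    by (intro conjI[OF r(1) conjI] allI impI) (erule r)+
qed

end
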